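(* Let $\mathcal{B}\subset\mathbb{R}^l$ be open, let $\mathcal{A}$ be the space of $C^\infty$ real functions on the phase space $\mathcal{B}\times\mathbb{T}^l$ with the Poisson bracket $\{\cdot,\cdot\}$, let $H_0=H_0(\mathbf{A})\in\mathcal{A}$ depend only on the actions $\mathbf{A}\in\mathcal{B}$, and let $\Gamma:\mathcal{A}\to\mathcal{A}$ be a linear operator satisfying $\{H_0\}^2\,\Gamma=\{H_0\}$. Put $\mathcal{N}=\{H_0\}\Gamma$ and $\mathcal{R}=1-\mathcal{N}$. Then for $V\in\mathcal{A}$, $$e^{\{\Gamma V\}}\bigl(H_0+V+f\bigr)=H_0+\mathcal{R}V,$$ where $$f=f(V)=e^{-\{\Gamma V\}}\mathcal{R}V+\frac{1-e^{-\{\Gamma V\}}}{\{\Gamma V\}}\,\mathcal{N}V-V .$$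
   Context: Coordinates on $\mathcal{B}\times\mathbb{T}^l$ ($\mathbb{T}^l$ the $l$-dimensional torus) are action-angle variables $(\mathbf{A},\boldsymbol{\varphi})$, and the Poisson bracket is $$\{H,H'\}=\frac{\partial H}{\partial \mathbf{A}}\cdot\frac{\partial H'}{\partial\boldsymbol{\varphi}}-\frac{\partial H}{\partial\boldsymbol{\varphi}}\cdot\frac{\partial H'}{\partial\mathbf{A}} .$$ For $H\in\mathcal{A}$, $\{H\}$ denotes the linear operator on $\mathcal{A}$ given by $\{H\}H'=\{H,H'\}$. The condition on $\Gamma$ means $\{H_0,\{H_0,\Gamma V\}\}=\{H_0,V\}$ for all $V\in\mathcal{A}$. The symbol $1$ in $\mathcal{R}=1-\mathcal{N}$ is the identity operator on $\mathcal{A}$. The operators built from $\{\Gamma V\}$ are defined by their expansions: $$e^{\pm\{\Gamma V\}}=\sum_{n=0}^{\infty}\frac{(\pm1)^n}{n!}\{\Gamma V\}^n,\qquad \frac{1-e^{-\{\Gamma V\}}}{\{\Gamma V\}}=\sum_{n=0}^{\infty}\frac{(-1)^n}{(n+1)!}\{\Gamma V\}^n .$$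
   Formalization: For general smooth V the defining series may diverge; the identity of functions is stated when the series in it converge pointwise on the phase space and f lies in 𝒜, and for every V in 𝒜 it is also stated, order by order, as an identity of formal expansions with V scaled by a formal parameter. *)

theory Defs
  imports "HOL-Analysis.Analysis" "HOL-Library.Function_Algebras"
begin

section \<open>Smooth functions on the phase space\<close>

text \<open>
  For open S: f is continuously differentiable k times on S. Only the values of f on S matter.
\<close>

fun Ck_on :: "nat \<Rightarrow> ('a::euclidean_space \<Rightarrow> real) \<Rightarrow> 'a set \<Rightarrow> bool" where
  "Ck_on 0 f S \<longleftrightarrow> continuous_on S f"
| "Ck_on (Suc k) f S \<longleftrightarrow> f differentiable_on S \<and>
     (\<forall>b\<in>Basis. Ck_on k (\<lambda>x. frechet_derivative f (at x) b) S)"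

definition smooth_on :: "('a::euclidean_space \<Rightarrow> real) \<Rightarrow> 'a set \<Rightarrow> bool" where
  "smooth_on f S \<longleftrightarrow> (\<forall>k. Ck_on k f S)"

text \<open>
  A point is a pair (A, phi) of actions and angles. Functions on the product of B with the
  torus are represented by their lifts to B times the universal cover of the torus, i.e.\ they
  are periodic of period 2 pi in every angle. Since HOL functions are total, the value
  outside the domain is fixed to be 0; thus equality of elements of \<open>observables B\<close> is
  equality of functions on the phase space, and \<open>observables B\<close> is a vector space.
\<close>

type_synonym 'l phase_fun = "(real ^ 'l) \<times> (real ^ 'l) \<Rightarrow> real"

definition observables :: "(real ^ 'l) set \<Rightarrow> ('l::finite) phase_fun set" where
  "observables B = {H. smooth_on H (B \<times> UNIV)
     \<and> (\<forall>A \<phi> i. H (A, \<phi> + axis i (2 * pi)) = H (A, \<phi>))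
     \<and> (\<forall>A \<phi>. A \<notin> B \<longrightarrow> H (A, \<phi>) = 0)}"

definition depends_only_on_actions :: "('l::finite) phase_fun \<Rightarrow> bool" where
  "depends_only_on_actions H \<longleftrightarrow> (\<forall>A \<phi> \<phi>'. H (A, \<phi>) = H (A, \<phi>'))"

definition linear_operator_on_observables ::
    "(real ^ 'l) set \<Rightarrow> (('l::finite) phase_fun \<Rightarrow> 'l phase_fun) \<Rightarrow> bool" where
  "linear_operator_on_observables B L \<longleftrightarrow>
     (\<forall>H\<in>observables B. L H \<in> observables B)
     \<and> (\<forall>H\<in>observables B. \<forall>H'\<in>observables B. L (H + H') = L H + L H')
     \<and> (\<forall>c. \<forall>H\<in>observables B. L (\<lambda>p. c * H p) = (\<lambda>p. c * L H p))"


section \<open>The Poisson bracket\<close>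

definition grad_action :: "('l::finite) phase_fun \<Rightarrow> (real ^ 'l) \<times> (real ^ 'l) \<Rightarrow> real ^ 'l" where
  "grad_action H p = (\<chi> i. frechet_derivative H (at p) (axis i 1, 0))"

definition grad_angle :: "('l::finite) phase_fun \<Rightarrow> (real ^ 'l) \<times> (real ^ 'l) \<Rightarrow> real ^ 'l" where
  "grad_angle H p = (\<chi> i. frechet_derivative H (at p) (0, axis i 1))"

text \<open>The linear operator written {H} in the literature is the partial application
  \<open>poisson B H\<close>.\<close>

definition poisson ::
    "(real ^ 'l) set \<Rightarrow> ('l::finite) phase_fun \<Rightarrow> 'l phase_fun \<Rightarrow> 'l phase_fun" where
  "poisson B H H' = (\<lambda>p. if fst p \<in> B
     then grad_action H p \<bullet> grad_angle H' p - grad_angle H p \<bullet> grad_action H' p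
     else 0)"

definition op_N ::
    "(real ^ 'l) set \<Rightarrow> ('l::finite) phase_fun \<Rightarrow> ('l phase_fun \<Rightarrow> 'l phase_fun)
      \<Rightarrow> 'l phase_fun \<Rightarrow> 'l phase_fun" where
  "op_N B H\<^sub>0 \<Gamma> V = poisson B H\<^sub>0 (\<Gamma> V)"

definition op_R ::
    "(real ^ 'l) set \<Rightarrow> ('l::finite) phase_fun \<Rightarrow> ('l phase_fun \<Rightarrow> 'l phase_fun)
      \<Rightarrow> 'l phase_fun \<Rightarrow> 'l phase_fun" where
  "op_R B H\<^sub>0 \<Gamma> V = V - op_N B H\<^sub>0 \<Gamma> V"


section \<open>Functions of an operator given by power series\<close>

text \<open>Coefficients of exp (s x) and of (1 - exp (- x)) / x.\<close>

definition exp_coeff :: "real \<Rightarrow> nat \<Rightarrow> real" where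
  "exp_coeff s n = s ^ n / fact n"

definition phi_coeff :: "nat \<Rightarrow> real" where
  "phi_coeff n = (-1) ^ n / fact (n + 1)"

text \<open>
  The sum over n of \<open>c n\<close> times the n-th iterate of X, applied to G. On smooth functions such a
  series need not converge; \<open>op_series\<close> is meaningful only if \<open>op_series_converges\<close>. Pointwise
  convergence on the phase space is used, the weakest of the usual modes of convergence.
\<close>

definition op_series ::
    "(nat \<Rightarrow> real) \<Rightarrow> ('l phase_fun \<Rightarrow> 'l phase_fun) \<Rightarrow> ('l::finite) phase_fun \<Rightarrow> 'l phase_fun" where
  "op_series c X G = (\<lambda>p. \<Sum>n. c n * (X ^^ n) G p)"

definition op_series_converges ::
    "(real ^ 'l) set \<Rightarrow> (nat \<Rightarrow> real) \<Rightarrow> ('l phase_fun \<Rightarrow> 'l phase_fun)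
      \<Rightarrow> ('l::finite) phase_fun \<Rightarrow> bool" where
  "op_series_converges B c X G \<longleftrightarrow>
     (\<forall>p \<in> B \<times> UNIV. summable (\<lambda>n. c n * (X ^^ n) G p))"

definition control_term ::
    "(real ^ 'l) set \<Rightarrow> ('l::finite) phase_fun \<Rightarrow> ('l phase_fun \<Rightarrow> 'l phase_fun)
      \<Rightarrow> 'l phase_fun \<Rightarrow> 'l phase_fun" where
  "control_term B H\<^sub>0 \<Gamma> V =
     op_series (exp_coeff (-1)) (poisson B (\<Gamma> V)) (op_R B H\<^sub>0 \<Gamma> V)
     + op_series phi_coeff (poisson B (\<Gamma> V)) (op_N B H\<^sub>0 \<Gamma> V) - V"


section \<open>The same expansions as formal power series in the perturbation\<close>

text \<open>
  Here V is replaced by eps V with a formal parameter eps. A formal power series in eps with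
  coefficients in the observables is given by its coefficient sequence. By linearity of Gamma,
  the operator {Gamma (eps V)} is eps times X, where X = {Gamma V}; so the coefficient of
  eps ^ k in the sum over n of c n (eps X) ^ n F involves only finitely many terms.
\<close>

type_synonym 'l formal_fun = "nat \<Rightarrow> 'l phase_fun"

definition order0 :: "('l::finite) phase_fun \<Rightarrow> 'l formal_fun" where
  "order0 G = (\<lambda>k. if k = 0 then G else 0)"

definition order1 :: "('l::finite) phase_fun \<Rightarrow> 'l formal_fun" where
  "order1 G = (\<lambda>k. if k = 1 then G else 0)"

definition formal_op_series ::
    "(nat \<Rightarrow> real) \<Rightarrow> ('l phase_fun \<Rightarrow> 'l phase_fun) \<Rightarrow> ('l::finite) formal_fun \<Rightarrow> 'l formal_fun" where
  "formal_op_series c X F = (\<lambda>k p. \<Sum>n\<le>k. c n * (X ^^ n) (F (k - n)) p)"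

definition formal_control_term ::
    "(real ^ 'l) set \<Rightarrow> ('l::finite) phase_fun \<Rightarrow> ('l phase_fun \<Rightarrow> 'l phase_fun)
      \<Rightarrow> 'l phase_fun \<Rightarrow> 'l formal_fun" where
  "formal_control_term B H\<^sub>0 \<Gamma> V =
     formal_op_series (exp_coeff (-1)) (poisson B (\<Gamma> V)) (order1 (op_R B H\<^sub>0 \<Gamma> V))
     + formal_op_series phi_coeff (poisson B (\<Gamma> V)) (order1 (op_N B H\<^sub>0 \<Gamma> V)) - order1 V"

end

theory Submission
  imports Defs "HOL-Complex_Analysis.Complex_Analysis"
begin

text \<open>
  Write \<open>X = {\<Gamma>V}\<close>. Since \<open>X H\<^sub>0 = - N V\<close>, the two series in the control term combine with \<open>H\<^sub>0\<close> into
  \<open>H\<^sub>0 + V + f = e\<^sup>-\<^sup>X (H\<^sub>0 + R V)\<close>, so the claim is that \<open>e\<^sup>X\<close> inverts \<open>e\<^sup>-\<^sup>X\<close>. For formal power series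
  this is the vanishing of the alternating binomial sums.

  Under mere pointwise convergence, restrict a smooth \<open>K\<close> to an integral curve of the Hamiltonian
  field of \<open>\<Gamma>V\<close>: the iterates \<open>X\<^sup>n K\<close> become the derivatives of a function \<open>w\<close> of one real variable, whose
  Taylor series at every \<open>t\<close> converges at \<open>t - 1\<close>. A smooth function whose Taylor series have radius
  of convergence at least 1 everywhere is analytic (Pringsheim and Boas, by Baire's theorem), so
  \<open>w\<close> extends holomorphically to the unit disc about each point. By Abel's theorem \<open>e\<^sup>-\<^sup>X\<close> acts on the
  extension as the shift by \<open>-1\<close>, although the curve itself need not exist for unit time, and \<open>e\<^sup>X\<close>
  shifts back.
\<close>

section \<open>Power series\<close>

text \<open>Only the germ at \<open>z\<close> matters: there \<open>f\<close> agrees with the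
  evaluation of the formal series \<open>Abs_fps a\<close>, whose convergence radius is positive, so
  the coefficients can be read off the expansion.\<close>

lemma higher_deriv_power_series:
  fixes f :: "complex \<Rightarrow> complex"
  assumes sums: "\<And>w. w \<in> ball z r \<Longrightarrow> (\<lambda>n. a n * (w - z) ^ n) sums f w" and "r > 0"
  shows "(deriv ^^ n) f z = fact n * a n"
proof -
  define F where "F = Abs_fps a"
  have sums': "(\<lambda>n. a n * x ^ n) sums f (z + x)" if "norm x < r" for x
    using sums[of "z + x"] that by (simp add: dist_norm)
  have "ereal (r / 2) \<le> conv_radius (fps_nth F)"
    using sums'[of "of_real (r / 2)"] \<open>r > 0\<close>
    by (intro conv_radius_geI_ex') (auto simp: F_def intro!: sums_summable sums')
  then have "fps_conv_radius F > 0"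
    using \<open>r > 0\<close> unfolding fps_conv_radius_def
    by (metis ereal_less(2) half_gt_zero less_le_trans)
  moreover have "\<forall>\<^sub>F x in nhds 0. eval_fps F x = f (z + x)"
    unfolding eventually_nhds_metric using \<open>r > 0\<close> sums'
    by (intro exI[of _ r]) (auto simp: eval_fps_def F_def sums_iff)
  ultimately have "(\<lambda>x. f (z + x)) has_fps_expansion F"
    by (simp add: has_fps_expansion_def)
  from fps_nth_fps_expansion[OF this, of n] show ?thesis
    by (simp add: F_def higher_deriv_shift_0[of n f z] o_def)
qed

text \<open>Abel's limit theorem in radial form. With \<open>b n\<close> the partial sums minus the
  limit, summation by parts gives \<open>(1 - r) * (\<Sum>n. b n * r ^ n)\<close> for the error, and
  \<open>b\<close> tends to 0.\<close>

lemma Abel_powser_tendsto_at_left_1: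
  fixes a :: "nat \<Rightarrow> 'a::{real_normed_field, banach}"
  assumes "summable a"
  shows "((\<lambda>r. \<Sum>n. a n * of_real r ^ n) \<longlongrightarrow> suminf a) (at_left (1::real))"
proof -
  define S where "S = suminf a"
  define b where "b n = (\<Sum>k\<le>n. a k) - S" for n
  have "a sums S" unfolding S_def using assms by (rule summable_sums)
  then have b0: "b \<longlonglongrightarrow> 0"
    unfolding b_def sums_def_le by (auto intro: LIM_zero)
  then obtain M where M: "\<And>n. norm (b n) \<le> M"
    using convergent_imp_Bseq[of b] unfolding convergent_def Bseq_def by blast
  have M0: "M \<ge> 0" using M[of 0] norm_ge_zero order_trans by blast
  have key: "(\<lambda>n. (1 - of_real r) * (b n * of_real r ^ n)) sums ((\<Sum>n. a n * of_real r ^ n) - S)"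
    and bsum: "summable (\<lambda>n. norm (b n) * r ^ n)"
    if r: "0 < r" "r < 1" for r :: real
  proof -
    have geo: "summable (\<lambda>n. M * r ^ n)" using r by (intro summable_mult summable_geometric) auto
    show bs: "summable (\<lambda>n. norm (b n) * r ^ n)"
      by (rule summable_comparison_test'[OF geo, of 0]) (use M r in \<open>auto intro: mult_right_mono\<close>)
    have bs': "summable (\<lambda>n. b n * of_real r ^ n)"
      by (rule summable_norm_cancel) (use bs r in \<open>simp add: norm_mult norm_power\<close>)
    have as: "summable (\<lambda>n. a n * of_real r ^ n)"
      using powser_inside[of a 1 "of_real r"] assms r by simp
    have lim0: "(\<lambda>n. b n * of_real r ^ Suc n) \<longlonglongrightarrow> 0"
      using tendsto_mult[OF summable_LIMSEQ_zero[OF bs'] tendsto_const, of "of_real r"]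
      by (simp add: mult_ac)
    have part: "(\<Sum>n\<le>N. (1 - of_real r) * (b n * of_real r ^ n))
        = (\<Sum>n\<le>N. a n * of_real r ^ n) - S - b N * of_real r ^ Suc N" for N
      by (induction N) (auto simp: b_def algebra_simps)
    have "(\<lambda>N. (\<Sum>n\<le>N. a n * of_real r ^ n) - S - b N * of_real r ^ Suc N)
        \<longlonglongrightarrow> (\<Sum>n. a n * of_real r ^ n) - S - 0"
      using as lim0 by (intro tendsto_diff tendsto_const) (simp_all add: summable_LIMSEQ')
    then show "(\<lambda>n. (1 - of_real r) * (b n * of_real r ^ n)) sums ((\<Sum>n. a n * of_real r ^ n) - S)"
      unfolding sums_def_le part by simp
  qed
  have "\<forall>\<^sub>F r in at_left (1::real). norm ((\<Sum>n. a n * of_real r ^ n) - S) < e" if "e > 0" for e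
  proof -
    obtain N where N: "\<And>n. n \<ge> N \<Longrightarrow> norm (b n) < e / 2"
      using LIMSEQ_D[OF b0, of "e / 2"] \<open>e > 0\<close> by auto
    \<comment> \<open>Split at \<open>N\<close>: the first terms carry the vanishing factor
      \<open>1 - r\<close>, while the tail is at most \<open>e / 2\<close> times a geometric series
      whose sum cancels that factor.\<close>
    have bound: "norm ((\<Sum>n. a n * of_real r ^ n) - S) \<le> (1 - r) * (\<Sum>n<N. norm (b n)) + e / 2"
      if r: "0 < r" "r < 1" for r :: real
    proof -
      have g: "(\<lambda>n. (e / 2) * r ^ n) sums (e / 2 * (1 / (1 - r)))"
        using r by (intro sums_mult geometric_sums) auto
      have f: "(\<lambda>n. if n < N then norm (b n) else 0) sums (\<Sum>n<N. norm (b n))"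
        using sums_If_finite_set[of "{..<N}" "\<lambda>n. norm (b n)"] by simp
      have "(\<Sum>n. norm (b n) * r ^ n) \<le> (\<Sum>n. (if n < N then norm (b n) else 0) + (e / 2) * r ^ n)"
      proof (rule suminf_le)
        show "norm (b n) * r ^ n \<le> (if n < N then norm (b n) else 0) + (e / 2) * r ^ n" for n
        proof (cases "n < N")
          case True
          have "norm (b n) * r ^ n \<le> norm (b n) * 1"
            using r by (intro mult_left_mono) (auto intro: power_le_one)
          moreover have "0 \<le> e / 2 * r ^ n" using r \<open>e > 0\<close> by simp
          ultimately show ?thesis using True by simp
        next
          case False
          then show ?thesis using N[of n] r by (auto intro!: mult_right_mono)
        qed
        show "summable (\<lambda>n. norm (b n) * r ^ n)" using bsum r by blast
        show "summable (\<lambda>n. (if n < N then norm (b n) else 0) + (e / 2) * r ^ n)"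
          using f g by (intro summable_add) (auto simp: sums_iff)
      qed
      also have "\<dots> = (\<Sum>n<N. norm (b n)) + e / 2 * (1 / (1 - r))"
        using sums_add[OF f g] by (simp add: sums_iff)
      finally have le: "(\<Sum>n. norm (b n) * r ^ n) \<le> (\<Sum>n<N. norm (b n)) + e / 2 * (1 / (1 - r))" .
      have nrm: "norm ((1 - of_real r) * (b n * of_real r ^ n)) = (1 - r) * (norm (b n) * r ^ n)" for n
      proof -
        have "norm (1 - of_real r :: 'a) = 1 - r"
          using r by (metis abs_of_pos diff_gt_0_iff_gt norm_of_real of_real_1 of_real_diff)
        then show ?thesis using r by (simp add: norm_mult norm_power)
      qed
      have "norm ((\<Sum>n. a n * of_real r ^ n) - S)
          = norm (\<Sum>n. (1 - of_real r) * (b n * of_real r ^ n))"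
        using key[OF r] by (simp add: sums_iff)
      also have "\<dots> \<le> (\<Sum>n. norm ((1 - of_real r) * (b n * of_real r ^ n)))"
        by (rule summable_norm) (use bsum[OF r] in \<open>simp add: nrm summable_mult\<close>)
      also have "\<dots> = (1 - r) * (\<Sum>n. norm (b n) * r ^ n)"
        unfolding nrm by (rule suminf_mult[OF bsum[OF r]])
      also have "\<dots> \<le> (1 - r) * ((\<Sum>n<N. norm (b n)) + e / 2 * (1 / (1 - r)))"
        using le r by (intro mult_left_mono) auto
      also have "\<dots> = (1 - r) * (\<Sum>n<N. norm (b n)) + e / 2"
        using r by (simp add: field_simps)
      finally show ?thesis .
    qed
    have "((\<lambda>r. (1 - r) * (\<Sum>n<N. norm (b n)) + e / 2) \<longlongrightarrow> (1 - 1) * (\<Sum>n<N. norm (b n)) + e / 2)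
        (at_left (1::real))"
      by (intro tendsto_intros)
    then have "\<forall>\<^sub>F r in at_left (1::real). (1 - r) * (\<Sum>n<N. norm (b n)) + e / 2 < e"
      by (rule order_tendstoD(2)) (use \<open>e > 0\<close> in simp)
    moreover have "\<forall>\<^sub>F r in at_left (1::real). r \<in> {0<..<1}"
      by (rule eventually_at_left_real) simp
    ultimately show ?thesis
      by eventually_elim (use bound in force)
  qed
  then show ?thesis
    unfolding tendsto_iff S_def[symmetric] by (simp add: dist_norm)
qed

section \<open>Smooth functions with uniformly large Taylor radius\<close>

text \<open>The factorial bound is what boundedness of the terms of a Taylor series at distance 1
  gives. The constant may depend on \<open>t\<close>; making it locally uniform is the purpose of
  this section.\<close>

definition derivative_tower :: "(nat \<Rightarrow> real \<Rightarrow> real) \<Rightarrow> real \<Rightarrow> real \<Rightarrow> bool" where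
  "derivative_tower D a b \<longleftrightarrow> (\<forall>t\<in>{a<..<b}.
     (\<forall>n. (D n has_real_derivative D (Suc n) t) (at t)) \<and> (\<exists>C. \<forall>n. \<bar>D n t\<bar> \<le> C * fact n))"

context
  fixes D :: "nat \<Rightarrow> real \<Rightarrow> real" and a b :: real
  assumes tower: "derivative_tower D a b"
begin

lemma tower_deriv: "t \<in> {a<..<b} \<Longrightarrow> (D n has_real_derivative D (Suc n) t) (at t)"
  and tower_bounded: "t \<in> {a<..<b} \<Longrightarrow> \<exists>C. \<forall>n. \<bar>D n t\<bar> \<le> C * fact n"
  using tower by (auto simp: derivative_tower_def)

text \<open>The argument is complex so that the identity theorem and Cauchy's inequality apply. The
  sum is known to converge on the unit disc about \<open>t\<close>.\<close>

definition taylor :: "real \<Rightarrow> complex \<Rightarrow> complex" where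
  "taylor t z = (\<Sum>n. of_real (D n t / fact n) * (z - of_real t) ^ n)"

lemma tower_continuous: "continuous_on {a<..<b} (D n)"
  using tower_deriv by (meson DERIV_isCont continuous_at_imp_continuous_on)

lemma coeff_bound:
  assumes "\<bar>D n t\<bar> \<le> C * fact n"
  shows "norm (of_real (D n t / fact n) * (z - of_real t) ^ n :: complex) \<le> C * norm (z - of_real t) ^ n"
proof -
  have "\<bar>D n t / fact n\<bar> \<le> C" using assms by (simp add: field_simps)
  then show ?thesis
    unfolding norm_mult norm_power norm_of_real by (intro mult_right_mono) auto
qed

lemma taylor_sums:
  assumes "t \<in> {a<..<b}" "z \<in> ball (of_real t) 1"
  shows "(\<lambda>n. of_real (D n t / fact n) * (z - of_real t) ^ n) sums taylor t z"
proof -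
  obtain C where "\<And>n. \<bar>D n t\<bar> \<le> C * fact n" using tower_bounded assms(1) by blast
  then have bnd: "norm (of_real (D n t / fact n) * (z - of_real t) ^ n :: complex)
      \<le> C * norm (z - of_real t) ^ n" for n
    using coeff_bound by blast
  have geo: "summable (\<lambda>n. C * norm (z - of_real t) ^ n)"
    using assms(2) by (intro summable_mult summable_geometric) (auto simp: dist_norm norm_minus_commute)
  have "summable (\<lambda>n. of_real (D n t / fact n) * (z - of_real t) ^ n :: complex)"
    by (rule summable_comparison_test'[OF geo, of 0]) (rule bnd)
  then show ?thesis unfolding taylor_def by (rule summable_sums)
qed

lemma taylor_holomorphic: "t \<in> {a<..<b} \<Longrightarrow> taylor t holomorphic_on ball (of_real t) 1"
  using taylor_sums by (rule power_series_holomorphic)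

lemma higher_deriv_taylor:
  "t \<in> {a<..<b} \<Longrightarrow> (deriv ^^ n) (taylor t) (of_real t) = of_real (D n t)"
  using higher_deriv_power_series[where r = 1, OF taylor_sums] by simp

lemma norm_taylor_le:
  assumes "t \<in> {a<..<b}" "\<And>n. \<bar>D n t\<bar> \<le> C * fact n" "norm (z - of_real t) < 1"
  shows "norm (taylor t z) \<le> C / (1 - norm (z - of_real t))"
proof -
  have g: "(\<lambda>n. C * norm (z - of_real t) ^ n) sums (C * (1 / (1 - norm (z - of_real t))))"
    using assms(3) by (intro sums_mult geometric_sums) auto
  have "norm (\<Sum>n. of_real (D n t / fact n) * (z - of_real t) ^ n :: complex)
      \<le> (\<Sum>n. C * norm (z - of_real t) ^ n)"
    using coeff_bound[OF assms(2)] sums_summable[OF g] by (intro norm_suminf_le)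
  then show ?thesis using g by (simp add: taylor_def sums_iff)
qed

text \<open>Agreement in order 0 propagates to all orders by differentiating along the real line,
  where the derivative of a restricted holomorphic function is its complex derivative.\<close>

lemma tower_eq_higher_deriv:
  assumes "open J" "J \<subseteq> {a<..<b}" "P holomorphic_on U" "open U" "of_real ` J \<subseteq> U"
    and "\<And>s. s \<in> J \<Longrightarrow> of_real (D 0 s) = P (of_real s)" "s \<in> J"
  shows "of_real (D n s) = (deriv ^^ n) P (of_real s)"
  using assms(7)
proof (induction n arbitrary: s)
  case (Suc n)
  have "((\<lambda>x. of_real (D n x) :: complex) has_vector_derivative of_real (D (Suc n) s)) (at s)"
    using tower_deriv[of s n] Suc.prems assms(2)
    by (intro has_vector_derivative_of_real) (auto simp: has_real_derivative_iff_has_vector_derivative)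
  then have 1: "((\<lambda>x. (deriv ^^ n) P (of_real x)) has_vector_derivative of_real (D (Suc n) s)) (at s)"
    by (rule has_vector_derivative_transform_within_open[OF _ \<open>open J\<close> Suc.prems Suc.IH])
  have "((deriv ^^ n) P has_field_derivative (deriv ^^ Suc n) P (of_real s)) (at (of_real s))"
    using holomorphic_derivI[OF holomorphic_higher_deriv[OF assms(3,4)] assms(4)] Suc.prems assms(5)
    by auto
  then have 2: "((\<lambda>x. (deriv ^^ n) P (of_real x)) has_vector_derivative (deriv ^^ Suc n) P (of_real s)) (at s)"
    by (rule has_vector_derivative_real_field)
  show ?case using vector_derivative_unique_at[OF 1 2] .
qed (use assms(6) in simp)

text \<open>A quantitative form of analyticity near \<open>t\<close>: one constant serves a whole
  neighbourhood. The rate \<open>2 ^ n\<close> is what Cauchy's inequality on circles of radius 1/2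
  yields in \<open>bound_transfer\<close>.\<close>

definition tame :: "real \<Rightarrow> bool" where
  "tame t \<longleftrightarrow> (\<exists>e>0. \<exists>C. \<forall>s. \<bar>s - t\<bar> < e \<longrightarrow> s \<in> {a<..<b} \<and> (\<forall>n. \<bar>D n s\<bar> \<le> C * 2 ^ n * fact n))"

text \<open>The Lagrange remainder of order \<open>N\<close> is at most
  \<open>C * (2 * \<bar>s - t\<bar>) ^ N\<close>, so the real Taylor series converges to
  \<open>D 0\<close> near \<open>t\<close>; the higher orders follow from
  \<open>tower_eq_higher_deriv\<close>.\<close>

lemma tame_imp_taylor:
  assumes "tame t"
  shows "\<exists>e>0. \<forall>s. \<bar>s - t\<bar> < e \<longrightarrow> s \<in> {a<..<b} \<and> (\<forall>n. of_real (D n s) = (deriv ^^ n) (taylor t) (of_real s))"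
proof -
  obtain e C where e: "e > 0" and
    C: "\<And>s n. \<bar>s - t\<bar> < e \<Longrightarrow> s \<in> {a<..<b} \<and> \<bar>D n s\<bar> \<le> C * 2 ^ n * fact n"
    using assms unfolding tame_def by blast
  \<comment> \<open>Below distance 1/2 the base \<open>2 * \<bar>s - t\<bar>\<close> of the
    remainder bound is less than 1.\<close>
  define d where "d = min e (1/2)"
  have d: "d > 0" "d \<le> e" "d \<le> 1/2" using e by (auto simp: d_def)
  have tab: "t \<in> {a<..<b}" using C[of t] e by simp
  have "\<bar>D 0 t\<bar> \<le> C" using C[of t 0] e by simp
  then have C0: "C \<ge> 0" by linarith
  have main: "of_real (D 0 s) = taylor t (of_real s)" if s: "\<bar>s - t\<bar> < d" for s
  proof -
    have "(\<lambda>N. \<Sum>m<N. D m t / fact m * (s - t) ^ m) \<longlonglongrightarrow> D 0 s"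
    proof (rule LIM_zero_cancel, rule Lim_null_comparison)
      show "\<forall>\<^sub>F N in sequentially. norm ((\<Sum>m<N. D m t / fact m * (s - t) ^ m) - D 0 s) \<le> C * (2 * \<bar>s - t\<bar>) ^ N"
      proof (rule eventually_sequentiallyI[of 1])
        fix N :: nat assume "1 \<le> N"
        show "norm ((\<Sum>m<N. D m t / fact m * (s - t) ^ m) - D 0 s) \<le> C * (2 * \<bar>s - t\<bar>) ^ N"
        proof (cases "s = t")
          case True
          have "(\<Sum>m<N. D m t / fact m * (s - t) ^ m) = D 0 t"
            using \<open>1 \<le> N\<close> True by (subst sum.remove[of _ 0]) (auto intro!: sum.neutral simp: power_0_left)
          then show ?thesis using True C0 by simp
        next
          case False
          have "\<exists>x. (if s < t then s < x \<and> x < t else t < x \<and> x < s) \<and>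
            D 0 s = (\<Sum>m<N. D m t / fact m * (s - t) ^ m) + D N x / fact N * (s - t) ^ N"
            by (rule Taylor[where a = "min s t" and b = "max s t"])
               (use \<open>1 \<le> N\<close> False s d C in \<open>auto intro!: tower_deriv split: if_splits simp: min_def max_def\<close>)
          then obtain x where between: "if s < t then s < x \<and> x < t else t < x \<and> x < s" and
            eq: "D 0 s = (\<Sum>m<N. D m t / fact m * (s - t) ^ m) + D N x / fact N * (s - t) ^ N"
            by blast
          have x: "\<bar>x - t\<bar> < e" using between s d by (simp split: if_splits)
          have "norm ((\<Sum>m<N. D m t / fact m * (s - t) ^ m) - D 0 s) = \<bar>D N x / fact N\<bar> * \<bar>s - t\<bar> ^ N"
            unfolding eq by (simp add: abs_mult power_abs)
          also have "\<dots> \<le> C * 2 ^ N * \<bar>s - t\<bar> ^ N"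
            using C[OF x, of N] by (intro mult_right_mono) (auto simp: field_simps)
          finally show ?thesis by (simp add: power_mult_distrib mult_ac)
        qed
      qed
      show "(\<lambda>N. C * (2 * \<bar>s - t\<bar>) ^ N) \<longlonglongrightarrow> 0"
        using s d by (intro tendsto_mult_right_zero LIMSEQ_realpow_zero) auto
    qed
    then have "(\<lambda>m. D m t / fact m * (s - t) ^ m) sums D 0 s" by (simp add: sums_def)
    then have "(\<lambda>m. of_real (D m t / fact m * (s - t) ^ m) :: complex) sums of_real (D 0 s)"
      by (rule sums_of_real)
    moreover have "(\<lambda>m. of_real (D m t / fact m * (s - t) ^ m) :: complex) sums taylor t (of_real s)"
      using taylor_sums[OF tab, of "of_real s"] s d
      by (simp add: dist_norm flip: of_real_diff)
    ultimately show ?thesis by (rule sums_unique2)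
  qed
  have "of_real (D n s) = (deriv ^^ n) (taylor t) (of_real s)" if "\<bar>s - t\<bar> < d" for s n
  proof (rule tower_eq_higher_deriv[where J = "ball t d" and U = "ball (of_real t) 1"])
    show "ball t d \<subseteq> {a<..<b}" using C d by (auto simp: dist_real_def)
    show "of_real ` ball t d \<subseteq> ball (of_real t :: complex) 1"
      using d by (auto simp: dist_of_real)
  qed (use that main taylor_holomorphic tab in \<open>auto simp: dist_real_def abs_minus_commute\<close>)
  then show ?thesis using d C by (intro exI[of _ d]) auto
qed

text \<open>Analytic continuation along \<open>T\<close>: the points where all derivatives agree
  with those of \<open>taylor t\<close> form a clopen subset of \<open>T\<close> containing
  \<open>t\<close>. Closedness is continuity; openness compares \<open>taylor t\<close> with
  \<open>taylor x\<close>, which represents \<open>D\<close> near \<open>x\<close> by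
  tameness.\<close>

lemma tame_connected_taylor:
  assumes "connected T" "T \<subseteq> {t - 1<..<t + 1}" "t \<in> T" "\<And>s. s \<in> T \<Longrightarrow> tame s" "s \<in> T"
  shows "of_real (D n s) = (deriv ^^ n) (taylor t) (of_real s)"
proof -
  have sub: "T \<subseteq> {a<..<b}"
    using tame_imp_taylor assms(4) by fastforce
  have hol: "taylor t holomorphic_on ball (of_real t) 1"
    using taylor_holomorphic sub assms(3) by blast
  have inball: "(of_real x :: complex) \<in> ball (of_real t) 1" if "x \<in> {t - 1<..<t + 1}" for x
    using that by (auto simp: dist_of_real dist_real_def)
  define A where "A = {s \<in> T. \<forall>n. of_real (D n s) = (deriv ^^ n) (taylor t) (of_real s)}"
  have "closedin (top_of_set T) {s \<in> T. of_real (D n s) - (deriv ^^ n) (taylor t) (of_real s) = 0}" for n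
  proof (rule continuous_closedin_preimage_constant)
    have "continuous_on T (\<lambda>x. (deriv ^^ n) (taylor t) (of_real x))"
    proof (rule continuous_on_compose2[where g = "(deriv ^^ n) (taylor t)" and f = of_real])
      show "continuous_on (ball (of_real t) 1) ((deriv ^^ n) (taylor t))"
        by (intro holomorphic_on_imp_continuous_on holomorphic_higher_deriv hol open_ball)
      show "of_real ` T \<subseteq> ball (of_real t :: complex) 1" using inball assms(2) by blast
    qed (intro continuous_intros)
    moreover have "continuous_on T (\<lambda>x. of_real (D n x) :: complex)"
      using continuous_on_subset[OF tower_continuous sub] by (intro continuous_intros)
    ultimately show "continuous_on T (\<lambda>s. of_real (D n s) - (deriv ^^ n) (taylor t) (of_real s))"
      by (intro continuous_on_diff)
  qed
  then have "closedin (top_of_set T) (\<Inter>n. {s \<in> T. of_real (D n s) - (deriv ^^ n) (taylor t) (of_real s) = 0})"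
    by (intro closedin_Inter) auto
  moreover have "(\<Inter>n. {s \<in> T. of_real (D n s) - (deriv ^^ n) (taylor t) (of_real s) = 0}) = A"
    by (auto simp: A_def)
  ultimately have clo: "closedin (top_of_set T) A" by simp
  have ope: "openin (top_of_set T) A"
    unfolding openin_euclidean_subtopology_iff
  proof (intro conjI ballI)
    show "A \<subseteq> T" by (auto simp: A_def)
    fix x assume x: "x \<in> A"
    then have "x \<in> T" by (auto simp: A_def)
    then obtain e where e: "e > 0" "\<And>s n. \<bar>s - x\<bar> < e \<Longrightarrow> of_real (D n s) = (deriv ^^ n) (taylor x) (of_real s)"
      using tame_imp_taylor assms(4) by meson
    \<comment> \<open>An intersection of two discs is convex, hence connected, so equality of all
      derivatives at \<open>x\<close> forces equality on all of it.\<close>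
    define W where "W = ball (of_real t :: complex) 1 \<inter> ball (of_real x) 1"
    have holx: "taylor x holomorphic_on ball (of_real x) 1" using taylor_holomorphic sub \<open>x \<in> T\<close> by blast
    have eq: "taylor x w = taylor t w" if "w \<in> W" for w
    proof (rule holomorphic_fun_eq_on_connected[where f = "taylor x" and g = "taylor t" and S = W and z = "of_real x"])
      show "taylor x holomorphic_on W" "taylor t holomorphic_on W"
        using hol holx by (auto simp: W_def intro: holomorphic_on_subset)
      show "open W" "connected W" by (auto simp: W_def intro: convex_connected convex_Int)
      show "(deriv ^^ n) (taylor x) (of_real x) = (deriv ^^ n) (taylor t) (of_real x)" for n
        using x higher_deriv_taylor[of x n] sub \<open>x \<in> T\<close> by (auto simp: A_def)
      show "of_real x \<in> W" using inball \<open>x \<in> T\<close> assms(2) by (auto simp: W_def)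
    qed (use that in auto)
    show "\<exists>e>0. \<forall>x'\<in>T. dist x' x < e \<longrightarrow> x' \<in> A"
    proof (intro exI[of _ "min e 1"] conjI ballI impI)
      fix y assume y: "y \<in> T" "dist y x < min e 1"
      have "(of_real y :: complex) \<in> W"
        using inball[of y] y assms(2) by (force simp: W_def dist_of_real dist_commute)
      then have "(deriv ^^ n) (taylor x) (of_real y) = (deriv ^^ n) (taylor t) (of_real y)" for n
        using hol holx eq
        by (intro higher_deriv_transform_within_open[where S = W]) (auto simp: W_def intro: holomorphic_on_subset)
      then show "y \<in> A" using y e(2)[of y] by (auto simp: A_def dist_real_def)
    qed (use e in auto)
  qed
  have "t \<in> A" using assms(3) higher_deriv_taylor[of t] sub by (auto simp: A_def)
  then have "A = T" using clo ope assms(1) by (auto simp: connected_clopen)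
  then show ?thesis using assms(5) by (auto simp: A_def)
qed

text \<open>Since \<open>\<alpha>\<close> itself need not be tame, the Taylor series is transported from \<open>t\<close> to \<open>\<alpha>\<close>:
  the one at \<open>t\<close> converges beyond \<open>\<alpha>\<close>, and continuity identifies its derivatives there.\<close>

lemma bound_transfer:
  assumes "\<alpha> \<in> {a<..<b}" "\<bar>t - \<alpha>\<bar> \<le> 1/4" "\<alpha> \<noteq> t" "\<And>n. \<bar>D n \<alpha>\<bar> \<le> m * fact n"
    and tame: "\<And>s. s \<in> insert t (open_segment \<alpha> t) \<Longrightarrow> tame s"
  shows "\<bar>D n t\<bar> \<le> 4 * m * 2 ^ n * fact n"
proof -
  define T where "T = insert t (open_segment \<alpha> t)"
  have Tsub: "T \<subseteq> closed_segment \<alpha> t" by (auto simp: T_def open_segment_def)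
  have seg: "\<bar>x - t\<bar> \<le> 1/4" if "x \<in> closed_segment \<alpha> t" for x
    using that assms(2) by (auto simp: closed_segment_eq_real_ivl split: if_splits)
  have clT: "closure T = closed_segment \<alpha> t"
    unfolding T_def closure_insert using assms(3) by (auto simp: closure_open_segment insert_absorb)
  have conT: "connected T"
    using connected_intermediate_closure[of "open_segment \<alpha> t" T] assms(3) Tsub
    convex_connected[OF convex_open_segment[of \<alpha> t]] by (auto simp: T_def closure_open_segment)
  have tab: "t \<in> {a<..<b}" using tame_imp_taylor[OF tame[of t]] by fastforce
  have hol: "taylor t holomorphic_on ball (of_real t) 1" and hola: "taylor \<alpha> holomorphic_on ball (of_real \<alpha>) 1"
    using taylor_holomorphic tab assms(1) by blast+
  have eqT: "of_real (D n s) = (deriv ^^ n) (taylor t) (of_real s)" if "s \<in> T" for n s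
  proof (rule tame_connected_taylor[OF conT _ _ _ that])
    show "T \<subseteq> {t - 1<..<t + 1}"
    proof
      fix x assume "x \<in> T"
      then have "\<bar>x - t\<bar> \<le> 1/4" using seg Tsub by blast
      then show "x \<in> {t - 1<..<t + 1}" unfolding greaterThanLessThan_iff by linarith
    qed
  qed (use tame in \<open>auto simp: T_def\<close>)
  have eqa: "of_real (D n \<alpha>) - (deriv ^^ n) (taylor t) (of_real \<alpha>) = 0" for n
  proof (rule continuous_constant_on_closure[where S = T])
    have sub: "closed_segment \<alpha> t \<subseteq> {a<..<b}"
      using tab assms(1) by (intro closed_segment_subset) auto
    have "continuous_on (closed_segment \<alpha> t) (\<lambda>x. (deriv ^^ n) (taylor t) (of_real x))"
    proof (rule continuous_on_compose2[where g = "(deriv ^^ n) (taylor t)" and f = of_real])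
      show "continuous_on (ball (of_real t) 1) ((deriv ^^ n) (taylor t))"
        by (intro holomorphic_on_imp_continuous_on holomorphic_higher_deriv hol open_ball)
      show "of_real ` closed_segment \<alpha> t \<subseteq> ball (of_real t :: complex) 1"
      proof
        fix y :: complex assume "y \<in> of_real ` closed_segment \<alpha> t"
        then obtain x where x: "x \<in> closed_segment \<alpha> t" "y = of_real x" by blast
        show "y \<in> ball (of_real t) 1" using seg[OF x(1)] unfolding x(2) mem_ball dist_of_real dist_real_def by linarith
      qed
    qed (intro continuous_intros)
    moreover have "continuous_on (closed_segment \<alpha> t) (\<lambda>x. of_real (D n x) :: complex)"
      using continuous_on_subset[OF tower_continuous sub] by (intro continuous_intros)
    ultimately show "continuous_on (closure T) (\<lambda>s. of_real (D n s) - (deriv ^^ n) (taylor t) (of_real s))"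
      unfolding clT by (intro continuous_on_diff)
  qed (use eqT clT in auto)
  define W where "W = ball (of_real t :: complex) 1 \<inter> ball (of_real \<alpha>) 1"
  have eq: "taylor t w = taylor \<alpha> w" if "w \<in> W" for w
  proof (rule holomorphic_fun_eq_on_connected[where f = "taylor t" and g = "taylor \<alpha>" and S = W and z = "of_real \<alpha>"])
    show "taylor \<alpha> holomorphic_on W" "taylor t holomorphic_on W"
      using hol hola by (auto simp: W_def intro: holomorphic_on_subset)
    show "open W" "connected W" by (auto simp: W_def intro: convex_connected convex_Int)
    show "(deriv ^^ n) (taylor t) (of_real \<alpha>) = (deriv ^^ n) (taylor \<alpha>) (of_real \<alpha>)" for n
      using eqa[of n] higher_deriv_taylor[OF assms(1), of n] by simp
    have "dist t \<alpha> < 1" using assms(2) unfolding dist_real_def by linarith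
    then show "of_real \<alpha> \<in> W" by (simp add: W_def dist_of_real)
  qed (use that in auto)
  have m0: "m \<ge> 0" using assms(4)[of 0] by simp
  \<comment> \<open>The circle of radius 1/2 about \<open>t\<close> stays within 1/2 + 1/4 = 3/4 of
    \<alpha>, where the geometric bound on \<open>taylor \<alpha>\<close> is at most
    \<open>m / (1/4)\<close>. The radius 1/2 produces the factor \<open>2 ^ n\<close>.\<close>
  have "norm ((deriv ^^ n) (taylor t) (of_real t)) \<le> fact n * (4 * m) / (1/2) ^ n"
  proof (rule Cauchy_inequality)
    show "taylor t holomorphic_on ball (of_real t) (1/2)"
      using hol by (rule holomorphic_on_subset) auto
    show "continuous_on (cball (of_real t) (1/2)) (taylor t)"
      using holomorphic_on_imp_continuous_on[OF hol] by (rule continuous_on_subset) auto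
    fix x :: complex assume x: "norm (of_real t - x) = 1/2"
    have "norm (x - of_real \<alpha>) \<le> norm (x - of_real t) + norm (of_real t - of_real \<alpha> :: complex)"
      using norm_triangle_ineq[of "x - of_real t" "of_real t - of_real \<alpha>"] by simp
    then have le: "norm (x - of_real \<alpha>) \<le> 3/4"
      using x assms(2) by (simp add: norm_minus_commute flip: of_real_diff)
    then have "x \<in> W" using x by (auto simp: W_def dist_norm norm_minus_commute)
    then have "norm (taylor t x) = norm (taylor \<alpha> x)" using eq by simp
    also have "\<dots> \<le> m / (1 - norm (x - of_real \<alpha>))"
      using le by (intro norm_taylor_le assms) auto
    also have "\<dots> \<le> m / (1/4)" using le m0 by (intro divide_left_mono) auto
    finally show "norm (taylor t x) \<le> 4 * m" by simp
  qed simp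
  then show ?thesis
    using higher_deriv_taylor[OF tab, of n] by (simp add: power_one_over field_simps)
qed

lemma tameI:
  assumes "e > 0" "\<And>s. \<bar>s - t\<bar> < e \<Longrightarrow> s \<in> {a<..<b}"
    and "\<And>s n. \<bar>s - t\<bar> < e \<Longrightarrow> \<bar>D n s\<bar> \<le> C * 2 ^ n * fact n"
  shows "tame t"
  unfolding tame_def using assms by blast

text \<open>Baire's theorem bounds the Taylor coefficients uniformly on a relatively open part of the set of
  points that are not tame; each gap of that set next to this part inherits the bound from its
  endpoint by \<open>bound_transfer\<close>.\<close>

lemma tame_everywhere:
  assumes "t \<in> {a<..<b}"
  shows "tame t"
proof (rule ccontr)
  assume "\<not> tame t"
  define E where "E = {s \<in> {a<..<b}. \<not> tame s}"
  have "open {s. tame s}"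
    unfolding open_dist
  proof (intro ballI)
    fix x assume "x \<in> {s. tame s}"
    then obtain e C where e: "e > 0" and
      C: "\<And>s. \<bar>s - x\<bar> < e \<Longrightarrow> s \<in> {a<..<b} \<and> (\<forall>n. \<bar>D n s\<bar> \<le> C * 2 ^ n * fact n)"
      unfolding mem_Collect_eq tame_def by blast
    have "tame y" if "dist y x < e / 2" for y
    proof (rule tameI[of "e / 2"])
      fix s assume "\<bar>s - y\<bar> < e / 2"
      then have "\<bar>s - x\<bar> < e" using that unfolding dist_real_def by linarith
      from C[OF this] show "s \<in> {a<..<b}" and "\<And>n. \<bar>D n s\<bar> \<le> C * 2 ^ n * fact n" by blast+
    qed (use e in simp)
    then show "\<exists>e>0. \<forall>y. dist y x < e \<longrightarrow> y \<in> {s. tame s}"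
      using e by (intro exI[of _ "e / 2"]) auto
  qed
  then have clE: "closed (- {s. tame s})" by (simp add: closed_Compl)
  obtain d where d: "d > 0" "cball t d \<subseteq> {a<..<b}"
    using assms open_contains_cball by (meson open_greaterThanLessThan)
  \<comment> \<open>Baire's theorem is applied to a closed set; the choice of \<open>d\<close> keeps
    this closure inside the interval, where the derivatives are controlled.\<close>
  define S where "S = closure (E \<inter> ball t d)"
  have Ssub: "S \<subseteq> {a<..<b}"
  proof -
    have "S \<subseteq> cball t d"
      unfolding S_def by (rule closure_minimal) auto
    then show ?thesis using d by blast
  qed
  have tS: "t \<in> S" using assms \<open>\<not> tame t\<close> d closure_subset by (fastforce simp: S_def E_def)
  \<comment> \<open>The sets where the constant can be taken to be \<open>m\<close>; they are closed
    because each \<open>D n\<close> is continuous, and the pointwise bounds make them cover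
    \<open>S\<close>.\<close>
  define A where "A m = {s \<in> S. \<forall>n. \<bar>D n s\<bar> \<le> real m * fact n}" for m :: nat
  have clA: "closedin (top_of_set S) (A m)" for m
  proof -
    have "closedin (top_of_set S) (S \<inter> D n -` {- (real m * fact n)..real m * fact n})" for n
      using continuous_on_subset[OF tower_continuous Ssub] by (intro continuous_closedin_preimage) auto
    then have "closedin (top_of_set S) (\<Inter>n. (S \<inter> D n -` {- (real m * fact n)..real m * fact n}))"
      by (intro closedin_Inter) auto
    moreover have "(\<Inter>n. (S \<inter> D n -` {- (real m * fact n)..real m * fact n})) = A m"
      by (auto simp: A_def abs_le_iff minus_le_iff)
    ultimately show ?thesis by simp
  qed
  \<comment> \<open>Otherwise all complements \<open>S - A m\<close> would be open and dense in
    \<open>S\<close>, hence also their intersection dense; but that intersection is empty while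
    \<open>S\<close> contains \<open>t\<close>.\<close>
  have "\<exists>m. \<not> S \<subseteq> closure (S - A m)"
  proof (rule ccontr)
    assume "\<not> (\<exists>m. \<not> S \<subseteq> closure (S - A m))"
    then have dense: "S \<subseteq> closure (\<Inter>(range (\<lambda>m. S - A m)))"
      using clA by (intro Baire) (auto simp: S_def)
    have empty: "\<Inter>(range (\<lambda>m. S - A m)) = {}"
    proof -
      have "\<exists>m. s \<in> A m" if "s \<in> S" for s
      proof -
        obtain C where C: "\<And>n. \<bar>D n s\<bar> \<le> C * fact n" using tower_bounded \<open>s \<in> S\<close> Ssub by blast
        obtain m :: nat where "C \<le> m" using real_arch_simple by blast
        then have "\<bar>D n s\<bar> \<le> real m * fact n" for n
          using C[of n] by (meson mult_right_mono fact_ge_zero order_trans)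
        then show ?thesis using that by (auto simp: A_def)
      qed
      then show ?thesis by blast
    qed
    show False using dense tS unfolding empty by simp
  qed
  then obtain m z where z: "z \<in> S" "z \<notin> closure (S - A m)" by blast
  then obtain e where "e > 0" "\<forall>x\<in>S - A m. \<not> dist x z < e"
    unfolding closure_approachable by blast
  then have e: "e > 0" "ball z e \<inter> (S - A m) = {}"
    by (auto simp: dist_commute)
  \<comment> \<open>The point \<open>z\<close> may be only a limit of points that are not tame; the
    contradiction is derived at such a point \<open>y\<close> nearby.\<close>
  have "\<exists>y\<in>E \<inter> ball t d. dist y z < e"
    using z(1) e(1) unfolding S_def closure_approachable by blast
  then obtain y where y: "y \<in> E" "y \<in> ball t d" "y \<in> ball z e"
    by (auto simp: dist_commute)
  have "open (ball t d \<inter> ball z e)" "y \<in> ball t d \<inter> ball z e" using y by auto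
  then obtain r0 where r0: "r0 > 0" "ball y r0 \<subseteq> ball t d \<inter> ball z e"
    by (meson openE)
  \<comment> \<open>The cap 1/4 is the distance allowed in \<open>bound_transfer\<close>.\<close>
  define r where "r = min r0 (1/4)"
  have r: "r > 0" "r \<le> 1/4" "ball y r \<subseteq> ball t d \<inter> ball z e"
    using r0 by (auto simp: r_def)
  have rab: "ball y r \<subseteq> {a<..<b}" using r(3) d(2) by (meson ball_subset_cball le_infE order_trans)
  have boundE: "\<bar>D n s\<bar> \<le> real m * fact n" if "s \<in> E" "s \<in> ball y r" for s n
  proof -
    have "s \<in> S" using that r(3) closure_subset unfolding S_def by fast
    then have "s \<in> A m" using that r(3) e(2) by blast
    then show ?thesis by (simp add: A_def)
  qed
  have "tame y"
  proof (rule tameI[of r])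
    fix s assume s: "\<bar>s - y\<bar> < r"
    then have sr: "s \<in> ball y r" by (simp add: dist_real_def abs_minus_commute)
    then show sab: "s \<in> {a<..<b}" using rab by blast
    fix n
    show "\<bar>D n s\<bar> \<le> 4 * real m * 2 ^ n * fact n"
    proof (cases "tame s")
      case False
      then have "\<bar>D n s\<bar> \<le> real m * fact n" using boundE sr sab by (simp add: E_def)
      also have "\<dots> \<le> (4 * real m * 2 ^ n) * fact n"
      proof (rule mult_right_mono)
        have "real m * 1 \<le> real m * (4 * 2 ^ n)"
          by (intro mult_left_mono) (use one_le_power[of "2::real" n] in linarith)+
        then show "real m \<le> 4 * real m * 2 ^ n" by simp
      qed simp
      finally show ?thesis .
    next
      case True
      \<comment> \<open>The nearest point \<alpha> of \<open>K\<close> to \<open>s\<close> is the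
        endpoint of the gap containing \<open>s\<close>: it satisfies the uniform bound, and
        everything strictly between it and \<open>s\<close> is tame. \<open>K\<close> is nonempty
        because it contains \<open>y\<close>.\<close>
      define K where "K = closed_segment s y \<inter> - {s. tame s}"
      have "closed K" unfolding K_def using clE by (intro closed_Int) auto
      moreover have "y \<in> K" using y(1) by (simp add: K_def E_def)
      ultimately obtain \<alpha> where \<alpha>: "\<alpha> \<in> K" "\<And>x. x \<in> K \<Longrightarrow> dist s \<alpha> \<le> dist s x"
        using distance_attains_inf[of K s] by blast
      have \<alpha>s: "\<bar>s - \<alpha>\<bar> \<le> \<bar>s - y\<bar>" using \<alpha>(2)[OF \<open>y \<in> K\<close>] by (simp add: dist_real_def)
      have "closed_segment s y \<subseteq> ball y r"
        using sr r(1) by (intro closed_segment_subset) auto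
      then have \<alpha>r: "\<alpha> \<in> ball y r" using \<alpha>(1) by (auto simp: K_def)
      have ne: "\<alpha> \<noteq> s" using \<alpha>(1) True by (auto simp: K_def)
      have "x \<notin> K" if "x \<in> open_segment \<alpha> s" for x
      proof
        assume "x \<in> K"
        then have "dist s \<alpha> \<le> dist s x" using \<alpha>(2) by blast
        moreover have "dist s x < dist s \<alpha>"
          using that dist_in_open_segment[OF that] by (metis dist_commute)
        ultimately show False by simp
      qed
      moreover have "open_segment \<alpha> s \<subseteq> closed_segment s y"
        using \<alpha>(1) by (metis IntD1 K_def closed_segment_subset convex_closed_segment ends_in_segment(1) segment_open_subset_closed subset_trans)
      ultimately have "tame x" if "x \<in> insert s (open_segment \<alpha> s)" for x
        using that True by (auto simp: K_def)
      moreover have "\<alpha> \<in> {a<..<b}" using \<alpha>r rab by blast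
      moreover have "\<bar>D n \<alpha>\<bar> \<le> real m * fact n" for n
        using boundE \<alpha>r \<alpha>(1) rab by (auto simp: E_def K_def)
      ultimately show ?thesis
        using \<alpha>s s r(2) ne by (intro bound_transfer[of \<alpha>]) auto
    qed
  qed (use r in auto)
  then show False using y(1) by (simp add: E_def)
qed

theorem taylor_eq:
  assumes "t \<in> {a<..<b}" "s \<in> {a<..<b}" "\<bar>s - t\<bar> < 1"
  shows "of_real (D n s) = (deriv ^^ n) (taylor t) (of_real s)"
proof (rule tame_connected_taylor)
  show "closed_segment t s \<subseteq> {t - 1<..<t + 1}"
    using assms(3) by (intro closed_segment_subset) auto
  have "closed_segment t s \<subseteq> {a<..<b}" using assms(1,2) by (intro closed_segment_subset) auto
  then show "tame x" if "x \<in> closed_segment t s" for x using that tame_everywhere by blast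
qed auto

lemma suminf_taylor_tendsto:
  assumes "t \<in> {a<..<b}" "norm u = 1" "summable (\<lambda>n. of_real (D n t / fact n) * u ^ n :: complex)"
  shows "((\<lambda>r. taylor t (of_real t + of_real r * u))
    \<longlongrightarrow> (\<Sum>n. of_real (D n t / fact n) * u ^ n)) (at_left 1)"
  using Abel_powser_tendsto_at_left_1[OF assms(3)] by (simp add: taylor_def power_mult_distrib mult_ac)

end

text \<open>If \<open>D\<close> are the derivatives of \<open>w\<close> and \<open>E\<close> those of \<open>g\<close>, the first series says that \<open>g t\<close> is the
  Taylor expansion of \<open>w\<close> at \<open>t\<close> evaluated at \<open>t - 1\<close>; then the expansion of \<open>g\<close> at 0, evaluated at 1,
  returns \<open>w 0\<close>.\<close>

theorem taylor_shift_inverse: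
  assumes "e > 0"
    and derD: "\<And>n t. \<bar>t\<bar> < e \<Longrightarrow> (D n has_real_derivative D (Suc n) t) (at t)"
    and derE: "\<And>n t. \<bar>t\<bar> < e \<Longrightarrow> (E n has_real_derivative E (Suc n) t) (at t)"
    and D: "\<And>t. \<bar>t\<bar> < e \<Longrightarrow> (\<lambda>n. (-1) ^ n / fact n * D n t) sums E 0 t"
    and E: "\<And>t. \<bar>t\<bar> < e \<Longrightarrow> summable (\<lambda>n. 1 / fact n * E n t)"
  shows "(\<Sum>n. 1 / fact n * E n 0) = D 0 0"
proof -
  \<comment> \<open>The terms of a convergent series are bounded, and here they have absolute value
    \<open>\<bar>F n\<bar> / fact n\<close>.\<close>
  have bnd: "\<exists>C. \<forall>n. \<bar>F n\<bar> \<le> C * fact n"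
    if sm: "summable (\<lambda>n. c n / fact n * F n)" and c: "\<And>n. \<bar>c n\<bar> = 1" for c F :: "nat \<Rightarrow> real"
  proof -
    obtain C where C: "\<And>n. \<bar>c n / fact n * F n\<bar> \<le> C"
      using summable_imp_bounded[OF sm] by (auto simp: bounded_iff)
    have "\<bar>F n\<bar> \<le> C * fact n" for n
      using C[of n] c[of n] by (simp add: abs_mult field_simps)
    then show ?thesis by blast
  qed
  \<comment> \<open>The cap 1 keeps every base point used below within unit distance of 0, as
    \<open>taylor_eq\<close> requires.\<close>
  define e' where "e' = min e 1"
  have e': "e' > 0" "e' \<le> e" "e' \<le> 1" using \<open>e > 0\<close> by (auto simp: e'_def)
  have towerD: "derivative_tower D (-e') e'"
    unfolding derivative_tower_def
  proof (intro ballI conjI allI)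
    fix t assume t: "t \<in> {-e'<..<e'}"
    then have te: "\<bar>t\<bar> < e" using e' by auto
    show "(D n has_real_derivative D (Suc n) t) (at t)" for n using derD te .
    show "\<exists>C. \<forall>n. \<bar>D n t\<bar> \<le> C * fact n"
      by (rule bnd[of "\<lambda>n. (-1) ^ n"]) (use D[OF te] in \<open>auto simp: sums_iff\<close>)
  qed
  have towerE: "derivative_tower E (-e') e'"
    unfolding derivative_tower_def
  proof (intro ballI conjI allI)
    fix t assume t: "t \<in> {-e'<..<e'}"
    then have te: "\<bar>t\<bar> < e" using e' by auto
    show "(E n has_real_derivative E (Suc n) t) (at t)" for n using derE te .
    show "\<exists>C. \<forall>n. \<bar>E n t\<bar> \<le> C * fact n"
      by (rule bnd[of "\<lambda>n. 1"]) (use E[OF te] in auto)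
  qed
  have z: "0 \<in> {-e'<..<e'}" using e' by simp
  have holD: "taylor D 0 holomorphic_on ball 0 1" and holE: "taylor E 0 holomorphic_on ball 0 1"
    using taylor_holomorphic[OF towerD z] taylor_holomorphic[OF towerE z] by simp_all
  \<comment> \<open>Positive \<open>t\<close> puts \<open>t - 1\<close> strictly inside the unit
    disc about 0, so \<open>taylor D 0\<close> is continuous there and the Abel limit can be
    evaluated; for \<open>t = 0\<close> the point would lie on the boundary.\<close>
  have shift: "of_real (E 0 t) = taylor D 0 (of_real t - 1)" if t: "0 < t" "t < e'" for t
  proof -
    have tI: "t \<in> {-e'<..<e'}" using t e' by auto
    have te: "\<bar>t\<bar> < e" using t e' by auto
    have s: "(\<lambda>n. of_real (D n t / fact n) * (-1) ^ n :: complex) sums of_real (E 0 t)"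
      using sums_of_real[OF D[OF te], where 'a = complex] by (simp add: mult_ac)
    \<comment> \<open>By \<open>taylor_eq\<close> both expansions have the derivatives
      \<open>D n t\<close> at \<open>t\<close>, so they agree on the common part of their
      discs.\<close>
    define W where "W = ball (of_real t :: complex) 1 \<inter> ball 0 1"
    have eq: "taylor D t w = taylor D 0 w" if "w \<in> W" for w
    proof (rule holomorphic_fun_eq_on_connected[where f = "taylor D t" and g = "taylor D 0" and S = W and z = "of_real t"])
      show "taylor D t holomorphic_on W" "taylor D 0 holomorphic_on W"
        using holD taylor_holomorphic[OF towerD tI] by (auto simp: W_def intro: holomorphic_on_subset)
      show "open W" "connected W" by (auto simp: W_def intro: convex_connected convex_Int)
      show "(deriv ^^ n) (taylor D t) (of_real t) = (deriv ^^ n) (taylor D 0) (of_real t)" for n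
        using higher_deriv_taylor[OF towerD tI, of n] taylor_eq[OF towerD z tI, of n] t e' by simp
      show "of_real t \<in> W" using t e' by (simp add: W_def)
    qed (use that in auto)
    have "((\<lambda>r. taylor D t (of_real t + of_real r * -1)) \<longlongrightarrow> of_real (E 0 t)) (at_left 1)"
      using suminf_taylor_tendsto[OF towerD tI, of "-1"] s by (simp add: sums_iff)
    moreover have "\<forall>\<^sub>F r in at_left 1. taylor D t (of_real t + of_real r * -1) = taylor D 0 (of_real t - of_real r)"
    proof (rule eventually_mono[OF eventually_at_left_real[of "t" 1]])
      show "t < 1" using t e' by simp
      fix r :: real assume r: "r \<in> {t<..<1}"
      have "of_real (t - r) \<in> W"
        unfolding W_def Int_iff mem_ball dist_norm of_real_diff[symmetric] using r t
        by (simp flip: of_real_diff)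
      then show "taylor D t (of_real t + of_real r * -1) = taylor D 0 (of_real t - of_real r)"
        using eq by simp
    qed
    ultimately have "((\<lambda>r. taylor D 0 (of_real t - of_real r)) \<longlongrightarrow> of_real (E 0 t)) (at_left 1)"
      by (rule Lim_transform_eventually)
    moreover have "((\<lambda>r. taylor D 0 (of_real t - of_real r)) \<longlongrightarrow> taylor D 0 (of_real t - 1)) (at_left 1)"
    proof -
      have "norm (of_real (t - 1) :: complex) < 1" unfolding norm_of_real using t e' by simp
      then have "of_real t - 1 \<in> ball (0::complex) 1" by (simp del: norm_of_real)
      then have "isCont (taylor D 0) (of_real t - 1)"
        using holD holomorphic_on_imp_continuous_on continuous_on_eq_continuous_at open_ball by blast
      then show ?thesis
        by (rule isCont_tendsto_compose) (auto intro!: tendsto_eq_intros)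
    qed
    ultimately show ?thesis using tendsto_unique trivial_limit_at_left_real by blast
  qed
  \<comment> \<open>On this lens both \<open>taylor E 0 w\<close> and
    \<open>taylor D 0 (w - 1)\<close> are holomorphic; the identity theorem extends
    \<open>shift\<close> from the real interval to all of it.\<close>
  define U where "U = ball (0::complex) 1 \<inter> ball 1 1"
  have EU: "taylor E 0 w - taylor D 0 (w - 1) = 0" if "w \<in> U" for w
  proof (rule analytic_continuation[where f = "\<lambda>w. taylor E 0 w - taylor D 0 (w - 1)" and S = U
        and U = "of_real ` {0<..<e'}" and \<xi> = "of_real (e' / 2)"])
    show "(\<lambda>w. taylor E 0 w - taylor D 0 (w - 1)) holomorphic_on U"
    proof (intro holomorphic_on_diff)
      show "taylor E 0 holomorphic_on U" using holE by (auto simp: U_def intro: holomorphic_on_subset)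
      have "(taylor D 0 \<circ> (\<lambda>w. w - 1)) holomorphic_on U"
        by (rule holomorphic_on_compose_gen[OF _ holD])
           (auto intro: holomorphic_intros simp: U_def dist_norm norm_minus_commute)
      then show "(\<lambda>w. taylor D 0 (w - 1)) holomorphic_on U" by (simp add: o_def)
    qed
    show "open U" "connected U" by (auto simp: U_def intro: convex_connected convex_Int)
    have in_U: "of_real x \<in> U" if "0 < x" "x < 1" for x
      using that dist_of_real[of 1 x, where 'a = complex] by (simp add: U_def dist_real_def)
    show "of_real ` {0<..<e'} \<subseteq> U" using in_U e' by auto
    show "of_real (e' / 2) \<in> U" by (rule in_U) (use e' in auto)
    show "(of_real (e' / 2) :: complex) islimpt of_real ` {0<..<e'}"
    proof (rule islimpt_isCont_image)
      show "e' / 2 islimpt {0<..<e'}"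
        using e' by (intro interior_limit_point) (simp add: interior_open)
      show "\<forall>\<^sub>F x in at (e' / 2). (of_real x :: complex) \<noteq> of_real (e' / 2)"
        by (auto simp: eventually_at_filter simp del: of_real_divide)
    qed (intro continuous_intros)
    fix x :: complex assume "x \<in> of_real ` {0<..<e'}"
    then obtain t where t: "x = of_real t" "0 < t" "t < e'" by auto
    have "of_real (E 0 t) = taylor E 0 (of_real t)"
      using taylor_eq[OF towerE z, of t 0] t e' by simp
    then show "taylor E 0 x - taylor D 0 (x - 1) = 0" using shift[of t] t by simp
  qed (use that in auto)
  have sE: "(\<lambda>n. of_real (E n 0 / fact n) * 1 ^ n :: complex) sums of_real (\<Sum>n. 1 / fact n * E n 0)"
    using sums_of_real[OF summable_sums[OF E[of 0]], where 'a = complex] \<open>e > 0\<close> by simp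
  \<comment> \<open>The point 1 lies on the boundary of \<open>U\<close>, so Abel's theorem is used
    again; on the other side \<open>r - 1\<close> tends to 0, an interior point for
    \<open>taylor D 0\<close>.\<close>
  have "((\<lambda>r. taylor E 0 (of_real r)) \<longlongrightarrow> of_real (\<Sum>n. 1 / fact n * E n 0)) (at_left 1)"
    using suminf_taylor_tendsto[OF towerE z, of 1] sE by (simp add: sums_iff)
  moreover have "\<forall>\<^sub>F r in at_left 1. taylor E 0 (of_real r) = taylor D 0 (of_real r - 1)"
  proof (rule eventually_mono[OF eventually_at_left_real[of 0 1]])
    fix r :: real assume r: "r \<in> {0<..<1}"
    then have "of_real r \<in> U" using dist_of_real[of 1 r, where 'a = complex] by (simp add: U_def dist_real_def)
    then show "taylor E 0 (of_real r) = taylor D 0 (of_real r - 1)" using EU[of "of_real r"] by simp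
  qed simp
  ultimately have "((\<lambda>r. taylor D 0 (of_real r - 1)) \<longlongrightarrow> of_real (\<Sum>n. 1 / fact n * E n 0)) (at_left 1)"
    by (rule Lim_transform_eventually)
  moreover have "((\<lambda>r. taylor D 0 (of_real r - 1)) \<longlongrightarrow> taylor D 0 0) (at_left 1)"
  proof -
    have "isCont (taylor D 0) 0"
      using holomorphic_on_imp_continuous_on[OF holD] by (simp add: continuous_on_eq_continuous_at)
    then show ?thesis
      by (rule isCont_tendsto_compose) (auto intro!: tendsto_eq_intros)
  qed
  ultimately have "taylor D 0 0 = of_real (\<Sum>n. 1 / fact n * E n 0)"
    using tendsto_unique trivial_limit_at_left_real by blast
  moreover have "taylor D 0 0 = of_real (D 0 0)" using higher_deriv_taylor[OF towerD z, of 0] by simp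
  ultimately show ?thesis by (metis of_real_eq_iff)
qed

section \<open>Calculus of smooth functions and of the bracket\<close>

text \<open>On an open set the derivative at a point depends only on the values in the set, which
  carries the induction. It lets derivative formulas valid only on \<open>S\<close> be substituted
  below.\<close>

lemma Ck_on_cong:
  assumes "open S" "\<And>x. x \<in> S \<Longrightarrow> f x = g x" "Ck_on k f S"
  shows "Ck_on k g S"
  using assms(2,3)
proof (induction k arbitrary: f g)
  case 0
  then show ?case by (simp cong: continuous_on_cong)
next
  case (Suc k)
  have diff: "f differentiable at x" if "x \<in> S" for x
    using Suc.prems(2) that \<open>open S\<close> by (auto simp: differentiable_on_eq_differentiable_at)
  have "g differentiable_on S"
    unfolding differentiable_on_def differentiable_def
  proof
    fix x assume "x \<in> S"
    then have "(f has_derivative frechet_derivative f (at x)) (at x within S)"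
      using diff frechet_derivative_works has_derivative_at_withinI by blast
    then show "\<exists>D. (g has_derivative D) (at x within S)"
      using has_derivative_transform[OF \<open>x \<in> S\<close>, of g f] Suc.prems(1) by metis
  qed
  moreover have "Ck_on k (\<lambda>x. frechet_derivative g (at x) b) S" if "b \<in> Basis" for b
  proof (rule Suc.IH)
    show "Ck_on k (\<lambda>x. frechet_derivative f (at x) b) S"
      using Suc.prems(2) that by simp
    show "frechet_derivative f (at x) b = frechet_derivative g (at x) b" if "x \<in> S" for x
      using frechet_derivative_transform_within_open[OF diff[OF that] \<open>open S\<close> that Suc.prems(1)]
      by simp
  qed
  ultimately show ?case by simp
qed

lemma Ck_on_SucD: "Ck_on (Suc k) f S \<Longrightarrow> Ck_on k f S"
proof (induction k arbitrary: f)
  case 0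
  then show ?case by (simp add: differentiable_imp_continuous_on)
next
  case (Suc k)
  have "Ck_on k (\<lambda>x. frechet_derivative f (at x) b) S" if "b \<in> Basis" for b
    using Suc.prems that by (intro Suc.IH) simp
  then show ?case using Suc.prems by simp
qed

lemma Ck_on_const: "Ck_on k (\<lambda>x. c) S"
  by (induction k arbitrary: c) auto

lemma Ck_on_add:
  assumes "open S" "Ck_on k f S" "Ck_on k g S"
  shows "Ck_on k (\<lambda>x. f x + g x) S"
  using assms(2,3)
proof (induction k arbitrary: f g)
  case 0
  then show ?case by (auto intro: continuous_intros)
next
  case (Suc k)
  have "Ck_on k (\<lambda>x. frechet_derivative (\<lambda>x. f x + g x) (at x) b) S" if "b \<in> Basis" for b
  proof (rule Ck_on_cong[OF \<open>open S\<close>])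
    show "Ck_on k (\<lambda>x. frechet_derivative f (at x) b + frechet_derivative g (at x) b) S"
      using Suc.prems that by (intro Suc.IH) auto
    fix x assume "x \<in> S"
    then have "f differentiable at x" "g differentiable at x"
      using Suc.prems \<open>open S\<close> by (auto simp: differentiable_on_eq_differentiable_at)
    then have "((\<lambda>x. f x + g x) has_derivative
        (\<lambda>h. frechet_derivative f (at x) h + frechet_derivative g (at x) h)) (at x)"
      by (intro has_derivative_add) (simp_all add: frechet_derivative_works[symmetric])
    from frechet_derivative_at[OF this]
    show "frechet_derivative f (at x) b + frechet_derivative g (at x) b
        = frechet_derivative (\<lambda>x. f x + g x) (at x) b" by metis
  qed
  then show ?case using Suc.prems by (auto intro: differentiable_on_add)
qed

text \<open>The product rule leaves one factor undifferentiated; \<open>Ck_on_SucD\<close> lowers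
  its order to match the induction hypothesis.\<close>

lemma Ck_on_mult:
  assumes "open S" "Ck_on k f S" "Ck_on k g S"
  shows "Ck_on k (\<lambda>x. f x * g x) S"
  using assms(2,3)
proof (induction k arbitrary: f g)
  case 0
  then show ?case by (auto intro: continuous_intros)
next
  case (Suc k)
  have "Ck_on k (\<lambda>x. frechet_derivative (\<lambda>x. f x * g x) (at x) b) S" if "b \<in> Basis" for b
  proof (rule Ck_on_cong[OF \<open>open S\<close>])
    show "Ck_on k (\<lambda>x. f x * frechet_derivative g (at x) b + frechet_derivative f (at x) b * g x) S"
      using Suc.prems that
      by (intro Ck_on_add[OF \<open>open S\<close>] Suc.IH) (auto intro: Ck_on_SucD)
    fix x assume "x \<in> S"
    then have "f differentiable at x" "g differentiable at x"
      using Suc.prems \<open>open S\<close> by (auto simp: differentiable_on_eq_differentiable_at)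
    then have "((\<lambda>x. f x * g x) has_derivative
        (\<lambda>h. f x * frechet_derivative g (at x) h + frechet_derivative f (at x) h * g x)) (at x)"
      by (intro has_derivative_mult) (simp_all add: frechet_derivative_works[symmetric])
    from frechet_derivative_at[OF this]
    show "f x * frechet_derivative g (at x) b + frechet_derivative f (at x) b * g x
        = frechet_derivative (\<lambda>x. f x * g x) (at x) b" by metis
  qed
  then show ?case using Suc.prems by (auto intro: differentiable_on_mult)
qed

lemma smooth_on_cong:
  assumes "open S" "\<And>x. x \<in> S \<Longrightarrow> f x = g x" "smooth_on f S"
  shows "smooth_on g S"
  using assms Ck_on_cong unfolding smooth_on_def by blast

lemma smooth_on_const: "smooth_on (\<lambda>x. c) S"
  by (simp add: smooth_on_def Ck_on_const)

lemma smooth_on_add: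
  "open S \<Longrightarrow> smooth_on f S \<Longrightarrow> smooth_on g S \<Longrightarrow> smooth_on (\<lambda>x. f x + g x) S"
  by (simp add: smooth_on_def Ck_on_add)

lemma smooth_on_mult:
  "open S \<Longrightarrow> smooth_on f S \<Longrightarrow> smooth_on g S \<Longrightarrow> smooth_on (\<lambda>x. f x * g x) S"
  by (simp add: smooth_on_def Ck_on_mult)

lemma smooth_on_cmult: "open S \<Longrightarrow> smooth_on f S \<Longrightarrow> smooth_on (\<lambda>x. c * f x) S"
  by (intro smooth_on_mult smooth_on_const)

lemma smooth_on_diff:
  assumes "open S" "smooth_on f S" "smooth_on g S"
  shows "smooth_on (\<lambda>x. f x - g x) S"
  using smooth_on_add[OF assms(1,2) smooth_on_cmult[OF assms(1,3), of "-1"]] by simp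

lemma smooth_on_sum:
  "open S \<Longrightarrow> (\<And>i. i \<in> I \<Longrightarrow> smooth_on (f i) S) \<Longrightarrow> smooth_on (\<lambda>x. \<Sum>i\<in>I. f i x) S"
  by (induction I rule: infinite_finite_induct) (auto simp: smooth_on_const smooth_on_add)

lemma smooth_on_frechet_derivative:
  assumes "smooth_on f S" "b \<in> Basis"
  shows "smooth_on (\<lambda>x. frechet_derivative f (at x) b) S"
  unfolding smooth_on_def
proof
  fix k
  show "Ck_on k (\<lambda>x. frechet_derivative f (at x) b) S"
    using assms Ck_on.simps(2)[of k f S] unfolding smooth_on_def by blast
qed

lemma smooth_on_differentiable:
  assumes "smooth_on f S" "open S" "x \<in> S"
  shows "f differentiable at x"
  using assms Ck_on.simps(2)[of 0 f S] unfolding smooth_on_def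
  by (metis differentiable_on_eq_differentiable_at)

lemma smooth_on_continuous: "smooth_on f S \<Longrightarrow> continuous_on S f"
  unfolding smooth_on_def by (metis Ck_on.simps(1))

section \<open>Partial derivatives and the bracket on smooth functions\<close>

lemma axis_pair_in_Basis:
  "(axis i 1, 0) \<in> (Basis :: ((real ^ 'l::finite) \<times> (real ^ 'l)) set)"
  "(0, axis i 1) \<in> (Basis :: ((real ^ 'l::finite) \<times> (real ^ 'l)) set)"
  by (auto simp: Basis_prod_def simp: axis_in_Basis_iff)

lemma smooth_on_grad:
  assumes "smooth_on H S"
  shows "smooth_on (\<lambda>p. grad_action H p $ i) S" "smooth_on (\<lambda>p. grad_angle H p $ i) S"
  using assms by (auto simp: grad_action_def grad_angle_def axis_pair_in_Basis
      intro: smooth_on_frechet_derivative)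

lemma smooth_on_poisson:
  assumes "open B" "smooth_on H (B \<times> UNIV)" "smooth_on H' (B \<times> UNIV)"
  shows "smooth_on (poisson B H H') (B \<times> UNIV)"
proof -
  have op: "open (B \<times> (UNIV :: (real ^ 'a) set))" using assms(1) by (simp add: open_Times)
  show ?thesis
  proof (rule smooth_on_cong[OF op])
    show "smooth_on (\<lambda>p. (\<Sum>i\<in>UNIV. grad_action H p $ i * grad_angle H' p $ i)
        - (\<Sum>i\<in>UNIV. grad_angle H p $ i * grad_action H' p $ i)) (B \<times> UNIV)"
      by (intro smooth_on_diff smooth_on_sum smooth_on_mult smooth_on_grad op assms)
  qed (auto simp: poisson_def inner_vec_def)
qed

lemma smooth_on_funpow_poisson:
  assumes "open B" "smooth_on H (B \<times> UNIV)" "smooth_on F (B \<times> UNIV)"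
  shows "smooth_on ((poisson B H ^^ n) F) (B \<times> UNIV)"
  using assms by (induction n) (auto intro: smooth_on_poisson)

lemma poisson_add:
  assumes "open B" "smooth_on F (B \<times> UNIV)" "smooth_on G (B \<times> UNIV)"
  shows "poisson B H (\<lambda>p. F p + G p) = (\<lambda>p. poisson B H F p + poisson B H G p)"
proof
  fix p
  show "poisson B H (\<lambda>p. F p + G p) p = poisson B H F p + poisson B H G p"
  proof (cases "fst p \<in> B")
    case True
    have op: "open (B \<times> (UNIV :: (real ^ 'a) set))" using assms(1) by (simp add: open_Times)
    have "p \<in> B \<times> UNIV" using True by (simp add: mem_Times_iff)
    then have "F differentiable at p" "G differentiable at p"
      using assms smooth_on_differentiable[OF _ op] by blast+
    then have "((\<lambda>p. F p + G p) has_derivative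
        (\<lambda>h. frechet_derivative F (at p) h + frechet_derivative G (at p) h)) (at p)"
      by (intro has_derivative_add) (simp_all add: frechet_derivative_works[symmetric])
    from frechet_derivative_at[OF this, symmetric]
    have "grad_action (\<lambda>p. F p + G p) p = grad_action F p + grad_action G p"
      "grad_angle (\<lambda>p. F p + G p) p = grad_angle F p + grad_angle G p"
      by (auto simp: grad_action_def grad_angle_def vec_eq_iff)
    then show ?thesis by (simp add: poisson_def inner_add_right)
  qed (simp add: poisson_def)
qed

lemma poisson_cmult:
  assumes "open B" "smooth_on F (B \<times> UNIV)"
  shows "poisson B H (\<lambda>p. c * F p) = (\<lambda>p. c * poisson B H F p)"
proof
  fix p
  show "poisson B H (\<lambda>p. c * F p) p = c * poisson B H F p"
  proof (cases "fst p \<in> B")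
    case True
    have op: "open (B \<times> (UNIV :: (real ^ 'a) set))" using assms(1) by (simp add: open_Times)
    have "p \<in> B \<times> UNIV" using True by (simp add: mem_Times_iff)
    then have "F differentiable at p"
      using assms smooth_on_differentiable[OF _ op] by blast
    then have "((\<lambda>p. c * F p) has_derivative (\<lambda>h. c * frechet_derivative F (at p) h)) (at p)"
      by (intro has_derivative_mult_right) (simp_all add: frechet_derivative_works[symmetric])
    from frechet_derivative_at[OF this, symmetric]
    have "grad_action (\<lambda>p. c * F p) p = c *\<^sub>R grad_action F p"
      "grad_angle (\<lambda>p. c * F p) p = c *\<^sub>R grad_angle F p"
      by (auto simp: grad_action_def grad_angle_def vec_eq_iff)
    then show ?thesis by (simp add: poisson_def algebra_simps)
  qed (simp add: poisson_def)
qed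

lemma funpow_poisson_add:
  assumes "open B" "smooth_on H (B \<times> UNIV)" "smooth_on F (B \<times> UNIV)" "smooth_on G (B \<times> UNIV)"
  shows "(poisson B H ^^ n) (\<lambda>p. F p + G p)
    = (\<lambda>p. (poisson B H ^^ n) F p + (poisson B H ^^ n) G p)"
  using assms by (induction n) (simp_all add: poisson_add smooth_on_funpow_poisson)

lemma funpow_poisson_cmult:
  assumes "open B" "smooth_on H (B \<times> UNIV)" "smooth_on F (B \<times> UNIV)"
  shows "(poisson B H ^^ n) (\<lambda>p. c * F p) = (\<lambda>p. c * (poisson B H ^^ n) F p)"
  using assms by (induction n) (simp_all add: poisson_cmult smooth_on_funpow_poisson)

lemma poisson_antisym: "poisson B H H' = (\<lambda>p. - poisson B H' H p)"
  by (auto simp: poisson_def inner_commute)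

section \<open>Integral curves of smooth vector fields\<close>

text \<open>Picard's theorem by the contraction principle on bounded continuous curves. Global
  bounds on \<open>F\<close> make the integral operator defined for every curve.\<close>

lemma Picard_global_Lipschitz:
  fixes F :: "'a::euclidean_space \<Rightarrow> 'a"
  assumes lip: "\<And>x y. dist (F x) (F y) \<le> L * dist x y" and bnd: "\<And>x. norm (F x) \<le> M" and "r > 0"
  obtains e u where "e > 0" "u 0 = p"
    "\<And>t. \<bar>t\<bar> < e \<Longrightarrow> norm (u t - p) \<le> r"
    "\<And>t. \<bar>t\<bar> < e \<Longrightarrow> (u has_vector_derivative F (u t)) (at t)"
proof -
  obtain b :: 'a where "b \<in> Basis" using nonempty_Basis by blast
  then have "norm (F b - F 0) \<le> L" using lip[of b 0] by (simp add: dist_norm)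
  then have L0: "L \<ge> 0" using norm_ge_zero order_trans by blast
  have M0: "M \<ge> 0" using bnd norm_ge_zero order_trans by blast
  \<comment> \<open>The bounds give \<open>4 * e * L \<le> 1 / 2\<close>, a contraction, and
    \<open>4 * e * M \<le> r\<close>, confinement to the ball. The 4 arises from two integrals over
    intervals of length at most \<open>2 * e\<close>.\<close>
  define e where "e = min 1 (min (1 / (8 * (L + 1))) (r / (4 * (M + 1))))"
  have e0: "e > 0" using L0 M0 \<open>r > 0\<close> by (auto simp: e_def)
  have "e \<le> 1 / (8 * (L + 1))" "e \<le> r / (4 * (M + 1))" by (auto simp: e_def)
  then have eL': "e * (8 * (L + 1)) \<le> 1" and eM': "e * (4 * (M + 1)) \<le> r"
    using L0 M0 by (simp_all add: field_simps)
  have eL: "4 * e * L \<le> 1 / 2" and eM: "4 * e * M \<le> r"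
    using eL' eM' e0 by (simp_all add: algebra_simps)
  \<comment> \<open>Clamping time to \<open>{-e..e}\<close> makes the image curve bounded and
    continuous on the whole line.\<close>
  define c where "c t = max (-e) (min e t)" for t :: real
  have c: "c t \<in> {-e..e}" for t using e0 by (auto simp: c_def)
  have c_id: "c t = t" if "t \<in> {-e..e}" for t using that by (auto simp: c_def)
  have contF: "continuous_on UNIV F"
  proof (rule continuous_at_imp_continuous_on, intro ballI)
    fix x :: 'a
    have "((\<lambda>y. L * dist y x) \<longlongrightarrow> L * dist x x) (at x)" by (intro tendsto_intros)
    then have "((\<lambda>y. L * dist y x) \<longlongrightarrow> 0) (at x)" by simp
    then have "((\<lambda>y. dist (F y) (F x)) \<longlongrightarrow> 0) (at x)"
      by (rule Lim_null_comparison[rotated]) (use lip in auto)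
    then show "isCont F x" unfolding isCont_def using tendsto_dist_iff by blast
  qed
  \<comment> \<open>Integrating from \<open>-e\<close> gives one formula for both signs of time;
    \<open>T0\<close> subtracts \<open>I u 0\<close> to restore the initial value
    \<open>p\<close>.\<close>
  define I where "I u s = integral {-e..s} (\<lambda>x. F (apply_bcontfun u x))" for u s
  have contFu: "continuous_on S (\<lambda>x. F (apply_bcontfun u x))" for u :: "real \<Rightarrow>\<^sub>C 'a" and S
    by (rule continuous_on_compose2[OF contF]) auto
  have I_der: "(I u has_vector_derivative F (apply_bcontfun u s)) (at s within {-e..e})"
    if "s \<in> {-e..e}" for u s
    unfolding I_def using integral_has_vector_derivative[OF contFu that] .
  have I_bnd: "norm (I u s) \<le> M * (2 * e)" if "s \<in> {-e..e}" for u s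
  proof -
    have "norm (I u s) \<le> M * (s - (- e))"
      unfolding I_def using that bnd by (intro integral_bound contFu) auto
    also have "\<dots> \<le> M * (2 * e)" using that M0 by (intro mult_left_mono) auto
    finally show ?thesis .
  qed
  have I_diff: "norm (I u s - I v s) \<le> L * dist u v * (2 * e)" if "s \<in> {-e..e}" for u v s
  proof -
    have int: "(\<lambda>x. F (apply_bcontfun w x)) integrable_on {-e..s}" for w
      using contFu by (rule integrable_continuous_interval)
    have "norm (F (apply_bcontfun u x) - F (apply_bcontfun v x)) \<le> L * dist u v" for x
    proof -
      have "norm (F (apply_bcontfun u x) - F (apply_bcontfun v x)) \<le> L * dist (apply_bcontfun u x) (apply_bcontfun v x)"
        using lip unfolding dist_norm .
      also have "\<dots> \<le> L * dist u v" using L0 dist_bounded by (intro mult_left_mono)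
      finally show ?thesis .
    qed
    then have "norm (integral {-e..s} (\<lambda>x. F (apply_bcontfun u x) - F (apply_bcontfun v x))) \<le> L * dist u v * (s - (- e))"
      using that by (intro integral_bound continuous_on_diff contFu) auto
    also have "\<dots> \<le> L * dist u v * (2 * e)" using that L0 by (intro mult_left_mono) auto
    finally show ?thesis by (simp add: I_def integral_diff[OF int int])
  qed
  define T0 where "T0 u t = p + (I u (c t) - I u 0)" for u t
  have z: "0 \<in> {-e..e}" using e0 by simp
  have T0: "T0 u \<in> bcontfun" for u
  proof (rule bcontfun_normI)
    have "continuous_on {-e..e} (I u)"
      using I_der has_vector_derivative_continuous continuous_on_eq_continuous_within by blast
    then have "continuous_on UNIV (\<lambda>t. I u (c t))"
      by (rule continuous_on_compose2) (use c in \<open>auto simp: c_def intro!: continuous_intros\<close>)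
    then show "continuous_on UNIV (T0 u)" unfolding T0_def by (intro continuous_intros)
    show "norm (T0 u t) \<le> norm p + (M * (2 * e) + M * (2 * e))" for t
      unfolding T0_def using I_bnd[OF c] I_bnd[OF z]
      by (intro norm_triangle_le add_mono norm_triangle_le_diff) auto
  qed
  define T where "T u = Bcontfun (T0 u)" for u
  have T: "apply_bcontfun (T u) = T0 u" for u
    unfolding T_def by (rule Bcontfun_inverse[OF T0])
  have "dist (T u) (T v) \<le> 1 / 2 * dist u v" for u v
  proof (rule dist_bound)
    fix t
    have "dist (apply_bcontfun (T u) t) (apply_bcontfun (T v) t) = norm ((I u (c t) - I v (c t)) - (I u 0 - I v 0))"
      unfolding T T0_def dist_norm by (simp add: algebra_simps)
    also have "\<dots> \<le> L * dist u v * (2 * e) + L * dist u v * (2 * e)"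
      by (rule order_trans[OF norm_triangle_ineq4 add_mono[OF I_diff[OF c] I_diff[OF z]]])
    also have "\<dots> = (4 * e * L) * dist u v" by simp
    also have "\<dots> \<le> 1 / 2 * dist u v" using eL by (intro mult_right_mono) auto
    finally show "dist (apply_bcontfun (T u) t) (apply_bcontfun (T v) t) \<le> 1 / 2 * dist u v" .
  qed
  then obtain u where u: "T u = u"
    using banach_fix_type[of "1/2" T] by auto
  then have eq: "apply_bcontfun u = T0 u" using T by metis
  show thesis
  proof (rule that[of e "apply_bcontfun u"])
    show "apply_bcontfun u 0 = p" unfolding eq T0_def using c_id[OF z] by simp
    fix t :: real assume t: "\<bar>t\<bar> < e"
    then have te: "t \<in> {-e..e}" by auto
    have "norm (I u (c t) - I u 0) \<le> M * (2 * e) + M * (2 * e)"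
      by (rule order_trans[OF norm_triangle_ineq4 add_mono[OF I_bnd[OF c] I_bnd[OF z]]])
    then show "norm (apply_bcontfun u t - p) \<le> r" using eM unfolding eq T0_def by (simp add: mult_ac)
    have "((\<lambda>s. p + (I u s - I u 0)) has_vector_derivative F (apply_bcontfun u t)) (at t within {-e..e})"
      using I_der[OF te] by (auto intro!: derivative_eq_intros)
    then have "((\<lambda>s. p + (I u s - I u 0)) has_vector_derivative F (apply_bcontfun u t)) (at t)"
      using t by (subst (asm) at_within_interior) auto
    then show "(apply_bcontfun u has_vector_derivative F (apply_bcontfun u t)) (at t)"
    proof (rule has_vector_derivative_transform_within_open[where S = "{-e<..<e}"])
      show "p + (I u s - I u 0) = apply_bcontfun u s" if "s \<in> {-e<..<e}" for s
        using that c_id[of s] by (simp add: eq T0_def)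
    qed (use t in auto)
  qed (rule e0)
qed

text \<open>The partial derivatives are continuous on a compact ball, hence bounded there, and the
  ball is convex, so the mean value inequality applies.\<close>

lemma smooth_on_Lipschitz_cball:
  fixes f :: "'a::euclidean_space \<Rightarrow> real"
  assumes "smooth_on f S" "open S" "cball p r \<subseteq> S"
  shows "\<exists>C. \<forall>x\<in>cball p r. \<forall>y\<in>cball p r. \<bar>f x - f y\<bar> \<le> C * dist x y"
proof -
  have "\<exists>C. \<forall>x\<in>cball p r. \<bar>frechet_derivative f (at x) b\<bar> \<le> C" if "b \<in> Basis" for b
  proof -
    have "continuous_on (cball p r) (\<lambda>x. frechet_derivative f (at x) b)"
      using smooth_on_continuous[OF smooth_on_frechet_derivative[OF assms(1) that]] assms(3)
      by (rule continuous_on_subset)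
    then have "bounded ((\<lambda>x. frechet_derivative f (at x) b) ` cball p r)"
      by (intro compact_imp_bounded compact_continuous_image) auto
    then show ?thesis by (auto simp: bounded_iff)
  qed
  then obtain C where C: "\<And>b x. b \<in> Basis \<Longrightarrow> x \<in> cball p r \<Longrightarrow> \<bar>frechet_derivative f (at x) b\<bar> \<le> C b"
    by metis
  have "norm (f x - f y) \<le> (\<Sum>b\<in>Basis. C b) * norm (x - y)" if xy: "x \<in> cball p r" "y \<in> cball p r" for x y
  proof (rule differentiable_bound[OF convex_cball[of p r] _ _ xy])
    fix z assume z: "z \<in> cball p r"
    have der: "(f has_derivative frechet_derivative f (at z)) (at z)"
      using smooth_on_differentiable[OF assms(1,2), of z] z assms(3) frechet_derivative_works by blast
    then show "(f has_derivative frechet_derivative f (at z)) (at z within cball p r)"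
      by (rule has_derivative_at_withinI)
    have lin: "linear (frechet_derivative f (at z))" using der has_derivative_linear by blast
    show "onorm (frechet_derivative f (at z)) \<le> (\<Sum>b\<in>Basis. C b)"
    proof (rule onorm_le)
      fix h
      have "frechet_derivative f (at z) h = frechet_derivative f (at z) (\<Sum>b\<in>Basis. (h \<bullet> b) *\<^sub>R b)"
        by (simp add: euclidean_representation)
      also have "\<dots> = (\<Sum>b\<in>Basis. (h \<bullet> b) * frechet_derivative f (at z) b)"
        by (simp add: linear_sum[OF lin] linear_cmul[OF lin])
      finally have "norm (frechet_derivative f (at z) h) \<le> (\<Sum>b\<in>Basis. \<bar>(h \<bullet> b) * frechet_derivative f (at z) b\<bar>)"
        by (simp add: sum_abs)
      also have "\<dots> \<le> (\<Sum>b\<in>Basis. norm h * C b)"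
        unfolding abs_mult by (intro sum_mono mult_mono C z) (auto simp: Basis_le_norm)
      also have "\<dots> = (\<Sum>b\<in>Basis. C b) * norm h" by (simp add: sum_distrib_left mult.commute)
      finally show "norm (frechet_derivative f (at z) h) \<le> (\<Sum>b\<in>Basis. C b) * norm h" .
    qed
  qed
  then show ?thesis unfolding dist_norm real_norm_def by blast
qed

text \<open>The field is Lipschitz only on a closed ball, so it is precomposed with the
  nearest-point projection \<open>q\<close>, which does not increase distances. The curve stays in
  the ball, where \<open>q\<close> is the identity.\<close>

lemma smooth_integral_curve:
  fixes F :: "'a::euclidean_space \<Rightarrow> 'a"
  assumes "open S" "p \<in> S" "\<And>b. b \<in> Basis \<Longrightarrow> smooth_on (\<lambda>x. F x \<bullet> b) S"
  obtains e u where "e > 0" "u 0 = p" "\<And>t. \<bar>t\<bar> < e \<Longrightarrow> u t \<in> S"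
    "\<And>t. \<bar>t\<bar> < e \<Longrightarrow> (u has_vector_derivative F (u t)) (at t)"
proof -
  obtain r where r: "r > 0" "cball p r \<subseteq> S" using assms(1,2) open_contains_cball by blast
  have "\<exists>C. \<forall>x\<in>cball p r. \<forall>y\<in>cball p r. \<bar>F x \<bullet> b - F y \<bullet> b\<bar> \<le> C * dist x y" if "b \<in> Basis" for b
    using smooth_on_Lipschitz_cball[OF assms(3)[OF that] assms(1) r(2)] .
  then obtain C where C: "\<And>b x y. b \<in> Basis \<Longrightarrow> x \<in> cball p r \<Longrightarrow> y \<in> cball p r
      \<Longrightarrow> \<bar>F x \<bullet> b - F y \<bullet> b\<bar> \<le> C b * dist x y"
    by metis
  define L where "L = (\<Sum>b\<in>Basis. \<bar>C b\<bar>)"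
  have lip: "dist (F x) (F y) \<le> L * dist x y" if "x \<in> cball p r" "y \<in> cball p r" for x y
  proof -
    have "dist (F x) (F y) \<le> (\<Sum>b\<in>Basis. \<bar>(F x - F y) \<bullet> b\<bar>)" unfolding dist_norm by (rule norm_le_l1)
    also have "\<dots> \<le> (\<Sum>b\<in>Basis. \<bar>C b\<bar> * dist x y)"
    proof (rule sum_mono)
      fix b :: 'a assume b: "b \<in> Basis"
      have "\<bar>(F x - F y) \<bullet> b\<bar> \<le> C b * dist x y" using C[OF b that] by (simp add: inner_diff_left)
      also have "\<dots> \<le> \<bar>C b\<bar> * dist x y" by (intro mult_right_mono) auto
      finally show "\<bar>(F x - F y) \<bullet> b\<bar> \<le> \<bar>C b\<bar> * dist x y" .
    qed
    finally show ?thesis by (simp add: L_def sum_distrib_right)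
  qed
  have L0: "L \<ge> 0" by (auto simp: L_def intro: sum_nonneg)
  define q where "q = closest_point (cball p r)"
  have q: "q x \<in> cball p r" for x unfolding q_def using r(1) by (intro closest_point_in_set) auto
  have q_id: "q x = x" if "x \<in> cball p r" for x unfolding q_def using that by (rule closest_point_self)
  have q_lip: "dist (q x) (q y) \<le> dist x y" for x y
    unfolding q_def using r(1) by (intro closest_point_lipschitz) auto
  have lipq: "dist (F (q x)) (F (q y)) \<le> L * dist x y" for x y
    using lip[OF q q, of x y] mult_left_mono[OF q_lip L0, of x y] by linarith
  have bndq: "norm (F (q x)) \<le> norm (F p) + L * r" for x
  proof -
    have "dist (F (q x)) (F p) \<le> L * dist (q x) p" using lip[OF q, of p] r(1) by simp
    also have "\<dots> \<le> L * r" using q[of x] L0 by (intro mult_left_mono) (auto simp: dist_commute)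
    finally show ?thesis using norm_triangle_sub[of "F (q x)" "F p"] by (simp add: dist_norm)
  qed
  obtain e u where eu: "e > 0" "u 0 = p" "\<And>t. \<bar>t\<bar> < e \<Longrightarrow> norm (u t - p) \<le> r"
    "\<And>t. \<bar>t\<bar> < e \<Longrightarrow> (u has_vector_derivative F (q (u t))) (at t)"
    using Picard_global_Lipschitz[OF lipq bndq r(1), of p] by metis
  have in_ball: "u t \<in> cball p r" if "\<bar>t\<bar> < e" for t using eu(3)[OF that] by (simp add: dist_norm norm_minus_commute)
  show thesis
    by (rule that[of e u]) (use eu in_ball q_id r in auto)
qed

section \<open>Exponentials of the bracket operator\<close>

lemma linear_vec_expand:
  fixes f :: "real ^ 'l::finite \<Rightarrow> real"
  assumes "linear f"
  shows "f x = (\<Sum>i\<in>UNIV. x $ i * f (axis i 1))"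
proof -
  have "f x = f (\<Sum>i\<in>UNIV. x $ i *\<^sub>R axis i 1)"
    using basis_expansion[of x] by (simp add: scalar_mult_eq_scaleR)
  then show ?thesis by (simp add: linear_sum[OF assms] linear_cmul[OF assms])
qed

text \<open>The velocity is given by Hamilton's equations with the actions as momenta, so the chain
  rule produces the bracket with \<open>H\<close> in the first slot.\<close>

lemma poisson_derivative_along_flow:
  assumes "open B" "smooth_on K (B \<times> UNIV)" "u t \<in> B \<times> UNIV"
    and "(u has_vector_derivative (- grad_angle H (u t), grad_action H (u t))) (at t)"
  shows "((\<lambda>s. K (u s)) has_real_derivative poisson B H K (u t)) (at t)"
proof -
  have op: "open (B \<times> (UNIV :: (real ^ 'a) set))" using assms(1) by (simp add: open_Times)
  define K' where "K' = frechet_derivative K (at (u t))"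
  have der: "(K has_derivative K') (at (u t))"
    unfolding K'_def using smooth_on_differentiable[OF assms(2) op assms(3)] frechet_derivative_works by blast
  have lin: "linear K'" using der has_derivative_linear by blast
  have "K' (- grad_angle H (u t), grad_action H (u t))
      = K' (- grad_angle H (u t), 0) + K' (0, grad_action H (u t))"
    by (simp flip: linear_add[OF lin])
  also have "K' (- grad_angle H (u t), 0) = - (grad_angle H (u t) \<bullet> grad_action K (u t))"
  proof -
    have "linear (\<lambda>x. K' (x, 0))"
      by (rule linear_compose[OF _ lin, unfolded o_def]) (simp add: linear_iff)
    from linear_vec_expand[OF this, of "- grad_angle H (u t)"] show ?thesis
      by (simp add: inner_vec_def grad_action_def K'_def sum_negf)
  qed
  also have "K' (0, grad_action H (u t)) = grad_action H (u t) \<bullet> grad_angle K (u t)"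
  proof -
    have "linear (\<lambda>x. K' (0, x))"
      by (rule linear_compose[OF _ lin, unfolded o_def]) (simp add: linear_iff)
    from linear_vec_expand[OF this, of "grad_action H (u t)"] show ?thesis
      by (simp add: inner_vec_def grad_angle_def K'_def)
  qed
  finally have "K' (- grad_angle H (u t), grad_action H (u t)) = poisson B H K (u t)"
    using assms(3) by (auto simp: poisson_def mem_Times_iff)
  moreover have "((K \<circ> u) has_vector_derivative K' (- grad_angle H (u t), grad_action H (u t))) (at t)"
    using vector_derivative_diff_chain_within[OF assms(4) has_derivative_at_withinI[OF der]] .
  ultimately show ?thesis
    by (simp add: has_real_derivative_iff_has_vector_derivative o_def)
qed

text \<open>Along the integral curve \<open>u\<close> through \<open>p\<close>, the iterates of the
  bracket on \<open>K\<close> and on \<open>G\<close> are the successive derivatives of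
  \<open>K \<circ> u\<close> and \<open>G \<circ> u\<close>, so \<open>taylor_shift_inverse\<close>
  applies. Convergence is used along the curve, not at \<open>p\<close> alone.\<close>

lemma exp_poisson_inverse:
  assumes "open B" "smooth_on H (B \<times> UNIV)" "smooth_on K (B \<times> UNIV)" "smooth_on G (B \<times> UNIV)"
    and G: "\<And>p. p \<in> B \<times> UNIV \<Longrightarrow> (\<lambda>n. (-1) ^ n / fact n * (poisson B H ^^ n) K p) sums G p"
    and smb: "\<And>p. p \<in> B \<times> UNIV \<Longrightarrow> summable (\<lambda>n. 1 / fact n * (poisson B H ^^ n) G p)"
    and p: "p \<in> B \<times> UNIV"
  shows "(\<Sum>n. 1 / fact n * (poisson B H ^^ n) G p) = K p"
proof -
  have op: "open (B \<times> (UNIV :: (real ^ 'a) set))" using assms(1) by (simp add: open_Times)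
  have smF: "smooth_on (\<lambda>x. (- grad_angle H x, grad_action H x) \<bullet> b) (B \<times> UNIV)" if "b \<in> Basis" for b
  proof -
    have "smooth_on (\<lambda>x. - (grad_angle H x \<bullet> v)) (B \<times> UNIV)" "smooth_on (\<lambda>x. grad_action H x \<bullet> v) (B \<times> UNIV)"
      if v_Basis: "v \<in> Basis" for v
    proof -
      obtain i where v: "v = axis i 1" using v_Basis by (auto simp: Basis_vec_def)
      show "smooth_on (\<lambda>x. - (grad_angle H x \<bullet> v)) (B \<times> UNIV)"
        using smooth_on_cmult[OF op smooth_on_grad(2)[OF assms(2), of i], of "-1"] by (simp add: v inner_axis)
      show "smooth_on (\<lambda>x. grad_action H x \<bullet> v) (B \<times> UNIV)"
        using smooth_on_grad(1)[OF assms(2), of i] by (simp add: v inner_axis)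
    qed
    then show ?thesis using that by (auto simp: Basis_prod_def)
  qed
  obtain e u where e: "e > 0" and u0: "u 0 = p" and u: "\<And>t. \<bar>t\<bar> < e \<Longrightarrow> u t \<in> B \<times> UNIV"
    and du: "\<And>t. \<bar>t\<bar> < e \<Longrightarrow> (u has_vector_derivative (- grad_angle H (u t), grad_action H (u t))) (at t)"
    by (rule smooth_integral_curve[where F = "\<lambda>x. (- grad_angle H x, grad_action H x)", OF op p smF]) blast+
  have "(\<Sum>n. 1 / fact n * (poisson B H ^^ n) G (u 0)) = (poisson B H ^^ 0) K (u 0)"
  proof (rule taylor_shift_inverse[OF e])
    fix t assume t: "\<bar>t\<bar> < e"
    show "((\<lambda>t. (poisson B H ^^ n) K (u t)) has_real_derivative (poisson B H ^^ Suc n) K (u t)) (at t)"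
      "((\<lambda>t. (poisson B H ^^ n) G (u t)) has_real_derivative (poisson B H ^^ Suc n) G (u t)) (at t)" for n
      using poisson_derivative_along_flow[OF assms(1) smooth_on_funpow_poisson u[OF t] du[OF t]] assms
      by simp_all
    show "(\<lambda>n. (-1) ^ n / fact n * (poisson B H ^^ n) K (u t)) sums (poisson B H ^^ 0) G (u t)"
      using G[OF u[OF t]] by simp
    show "summable (\<lambda>n. 1 / fact n * (poisson B H ^^ n) G (u t))" using smb[OF u[OF t]] .
  qed
  then show ?thesis by (simp add: u0)
qed

section \<open>Formal series and the control term\<close>

lemma smooth_on_zero: "smooth_on 0 S"
  using smooth_on_const[of 0 S] by (simp add: zero_fun_def)

lemma funpow_poisson_zero:
  assumes "open B" "smooth_on H (B \<times> UNIV)"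
  shows "(poisson B H ^^ n) 0 = 0"
  using funpow_poisson_cmult[OF assms smooth_on_zero, of n 0] by (simp add: zero_fun_def)

text \<open>The argument is concentrated in order 1, so at order \<open>k\<close> only the summand
  \<open>n = k - 1\<close> can survive, and none does at order 0.\<close>

lemma formal_op_series_order1:
  assumes "open B" "smooth_on H (B \<times> UNIV)"
  shows "formal_op_series c (poisson B H) (order1 G) k p
    = (case k of 0 \<Rightarrow> 0 | Suc j \<Rightarrow> c j * (poisson B H ^^ j) G p)"
proof (cases k)
  case 0
  then show ?thesis by (simp add: formal_op_series_def order1_def)
next
  case (Suc j)
  have "(\<Sum>n\<le>k. c n * (poisson B H ^^ n) (order1 G (k - n)) p)
      = (\<Sum>n\<le>k. if n = j then c j * (poisson B H ^^ j) G p else 0)"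
    using Suc funpow_poisson_zero[OF assms] by (intro sum.cong) (auto simp: order1_def)
  then show ?thesis using Suc by (simp add: formal_op_series_def)
qed

text \<open>The coefficients of \<open>exp x * exp (- x) = 1\<close>: times \<open>fact k\<close>,
  the sum is the binomial expansion of \<open>(1 - 1) ^ k\<close>.\<close>

lemma sum_inverse_fact_alternating:
  "(\<Sum>n\<le>k. 1 / fact n * ((-1) ^ (k - n) / fact (k - n))) = (if k = 0 then 1 else 0 :: real)"
proof -
  have "(\<Sum>n\<le>k. 1 / fact n * ((-1) ^ (k - n) / fact (k - n)))
      = (\<Sum>n\<le>k. of_nat (k choose n) * 1 ^ n * (-1) ^ (k - n)) / (fact k :: real)"
    unfolding sum_divide_distrib by (intro sum.cong) (auto simp: binomial_fact)
  also have "\<dots> = (1 + -1) ^ k / fact k" by (subst binomial_ring) simp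
  finally show ?thesis by simp
qed

text \<open>By antisymmetry \<open>N V = - X H\<^sub>0\<close>, so iterates on \<open>N V\<close>
  are the next iterates on \<open>H\<^sub>0\<close>, up to sign.\<close>

lemma funpow_op_N:
  assumes "open B" "smooth_on (\<Gamma> V) (B \<times> UNIV)" "smooth_on H\<^sub>0 (B \<times> UNIV)"
  shows "(poisson B (\<Gamma> V) ^^ n) (op_N B H\<^sub>0 \<Gamma> V) p = - (poisson B (\<Gamma> V) ^^ Suc n) H\<^sub>0 p"
proof -
  have N: "op_N B H\<^sub>0 \<Gamma> V = (\<lambda>p. -1 * poisson B (\<Gamma> V) H\<^sub>0 p)"
    unfolding op_N_def using poisson_antisym[of B H\<^sub>0 "\<Gamma> V"] by simp
  show ?thesis
    unfolding N funpow_poisson_cmult[OF assms(1,2) smooth_on_poisson[OF assms]]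
    by (simp add: funpow_swap1)
qed

text \<open>By \<open>funpow_op_N\<close> the \<open>phi_coeff\<close> series is the exponential
  series of \<open>-X\<close> on \<open>H\<^sub>0\<close> without its leading term. Adding
  \<open>H\<^sub>0\<close> completes it, and \<open>V\<close> cancels against the \<open>- V\<close>
  in the control term.\<close>

lemma exp_minus_eq_control_term:
  assumes "open B" "smooth_on (\<Gamma> V) (B \<times> UNIV)" "smooth_on H\<^sub>0 (B \<times> UNIV)"
    and "smooth_on (op_R B H\<^sub>0 \<Gamma> V) (B \<times> UNIV)"
    and "op_series_converges B (exp_coeff (-1)) (poisson B (\<Gamma> V)) (op_R B H\<^sub>0 \<Gamma> V)"
    and "op_series_converges B phi_coeff (poisson B (\<Gamma> V)) (op_N B H\<^sub>0 \<Gamma> V)"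
    and "p \<in> B \<times> UNIV"
  shows "(\<lambda>n. (-1) ^ n / fact n * (poisson B (\<Gamma> V) ^^ n) (\<lambda>p. H\<^sub>0 p + op_R B H\<^sub>0 \<Gamma> V p) p)
    sums (H\<^sub>0 + V + control_term B H\<^sub>0 \<Gamma> V) p"
proof -
  define X where "X = poisson B (\<Gamma> V)"
  define N where "N = op_N B H\<^sub>0 \<Gamma> V"
  define R where "R = op_R B H\<^sub>0 \<Gamma> V"
  have XN: "(X ^^ n) N p = - (X ^^ Suc n) H\<^sub>0 p" for n
    unfolding X_def N_def using assms(1-3) by (rule funpow_op_N)
  have "summable (\<lambda>n. phi_coeff n * (X ^^ n) N p)"
    using assms(6,7) unfolding op_series_converges_def X_def N_def by blast
  then have "(\<lambda>n. phi_coeff n * (X ^^ n) N p) sums op_series phi_coeff X N p"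
    unfolding op_series_def by (rule summable_sums)
  then have "(\<lambda>n. (-1) ^ Suc n / fact (Suc n) * (X ^^ Suc n) H\<^sub>0 p) sums op_series phi_coeff X N p"
    by (simp add: phi_coeff_def XN del: fact_Suc)
  \<comment> \<open>Restores the term \<open>n = 0\<close>, which is \<open>H\<^sub>0\<close>
    itself.\<close>
  then have H: "(\<lambda>n. (-1) ^ n / fact n * (X ^^ n) H\<^sub>0 p) sums (op_series phi_coeff X N p + H\<^sub>0 p)"
    using sums_Suc[of "\<lambda>n. (-1) ^ n / fact n * (X ^^ n) H\<^sub>0 p"] by simp
  have "summable (\<lambda>n. exp_coeff (-1) n * (X ^^ n) R p)"
    using assms(5,7) unfolding op_series_converges_def X_def R_def by blast
  then have "(\<lambda>n. (-1) ^ n / fact n * (X ^^ n) R p) sums op_series (exp_coeff (-1)) X R p"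
    unfolding op_series_def exp_coeff_def by (rule summable_sums)
  from sums_add[OF H this] have "(\<lambda>n. (-1) ^ n / fact n * (X ^^ n) (\<lambda>p. H\<^sub>0 p + R p) p)
      sums (op_series phi_coeff X N p + H\<^sub>0 p + op_series (exp_coeff (-1)) X R p)"
    by (simp add: X_def R_def funpow_poisson_add[OF assms(1-4)] distrib_left)
  then show ?thesis by (simp add: control_term_def X_def N_def R_def algebra_simps)
qed

text \<open>These are the coefficients of the exponential of \<open>- eps X\<close> on
  \<open>H\<^sub>0 + eps R V\<close>. As \<open>R V\<close> enters at order 1, its iterates lag by
  one; at \<open>k = 0\<close> its coefficient is 0, so the truncated \<open>k - 1\<close> is
  harmless.\<close>

lemma formal_control_term_eq:
  assumes "open B" "smooth_on (\<Gamma> V) (B \<times> UNIV)" "smooth_on H\<^sub>0 (B \<times> UNIV)"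
  shows "(order0 H\<^sub>0 + order1 V + formal_control_term B H\<^sub>0 \<Gamma> V) k
    = (\<lambda>p. (-1) ^ k / fact k * (poisson B (\<Gamma> V) ^^ k) H\<^sub>0 p
        + (case k of 0 \<Rightarrow> 0 | Suc j \<Rightarrow> (-1) ^ j / fact j)
          * (poisson B (\<Gamma> V) ^^ (k - 1)) (op_R B H\<^sub>0 \<Gamma> V) p)"
proof
  fix p
  define X where "X = poisson B (\<Gamma> V)"
  define N where "N = op_N B H\<^sub>0 \<Gamma> V"
  define R where "R = op_R B H\<^sub>0 \<Gamma> V"
  have XN: "(X ^^ n) N p = - (X ^^ Suc n) H\<^sub>0 p" for n
    unfolding X_def N_def using assms by (rule funpow_op_N)
  have ser: "formal_op_series c X (order1 Q) k p = (case k of 0 \<Rightarrow> 0 | Suc j \<Rightarrow> c j * (X ^^ j) Q p)" for c Q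
    unfolding X_def by (rule formal_op_series_order1[OF assms(1,2)])
  have "(order0 H\<^sub>0 + order1 V + formal_control_term B H\<^sub>0 \<Gamma> V) k p = order0 H\<^sub>0 k p
      + formal_op_series (exp_coeff (-1)) X (order1 R) k p + formal_op_series phi_coeff X (order1 N) k p"
    by (simp add: formal_control_term_def X_def R_def N_def)
  also have "\<dots> = (-1) ^ k / fact k * (X ^^ k) H\<^sub>0 p
      + (case k of 0 \<Rightarrow> 0 | Suc j \<Rightarrow> (-1) ^ j / fact j) * (X ^^ (k - 1)) R p"
    unfolding ser
    by (cases k) (simp_all add: XN order0_def exp_coeff_def phi_coeff_def del: fact_Suc funpow.simps)
  finally show "(order0 H\<^sub>0 + order1 V + formal_control_term B H\<^sub>0 \<Gamma> V) k p
    = (-1) ^ k / fact k * (poisson B (\<Gamma> V) ^^ k) H\<^sub>0 p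
        + (case k of 0 \<Rightarrow> 0 | Suc j \<Rightarrow> (-1) ^ j / fact j)
          * (poisson B (\<Gamma> V) ^^ (k - 1)) (op_R B H\<^sub>0 \<Gamma> V) p"
    unfolding X_def R_def .
qed

text \<open>At order \<open>k\<close> the composition of iterates collapses to one power of
  \<open>X\<close> on \<open>P\<close> and one on \<open>Q\<close>; their scalar coefficients are
  alternating sums that vanish except at orders 0 and 1 respectively.\<close>

lemma formal_exp_inverse:
  assumes "open B" "smooth_on H (B \<times> UNIV)" "smooth_on P (B \<times> UNIV)" "smooth_on Q (B \<times> UNIV)"
    and F: "\<And>k. F k = (\<lambda>p. (-1) ^ k / fact k * (poisson B H ^^ k) P p
        + (case k of 0 \<Rightarrow> 0 | Suc j \<Rightarrow> (-1) ^ j / fact j) * (poisson B H ^^ (k - 1)) Q p)"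
  shows "formal_op_series (exp_coeff 1) (poisson B H) F = order0 P + order1 Q"
proof (intro ext)
  fix k p
  define X where "X = poisson B H"
  define c :: "nat \<Rightarrow> real" where "c k = (case k of 0 \<Rightarrow> 0 | Suc j \<Rightarrow> (-1) ^ j / fact j)" for k
  have op: "open (B \<times> (UNIV :: (real ^ 'a) set))" using assms(1) by (simp add: open_Times)
  have sP: "smooth_on ((X ^^ m) P) (B \<times> UNIV)" and sQ: "smooth_on ((X ^^ m) Q) (B \<times> UNIV)" for m
    unfolding X_def using assms(1-4) smooth_on_funpow_poisson by blast+
  have XF: "(X ^^ n) (F (k - n)) p
      = (-1) ^ (k - n) / fact (k - n) * (X ^^ k) P p + c (k - n) * (X ^^ (k - 1)) Q p" if "n \<le> k" for n
  proof -
    have comp: "(X ^^ n) ((X ^^ m) Q) = (X ^^ (n + m)) Q" for m Q by (simp add: funpow_add)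
    have cm: "(X ^^ n) (\<lambda>p. a * G p) = (\<lambda>p. a * (X ^^ n) G p)" if "smooth_on G (B \<times> UNIV)" for a G
      unfolding X_def using assms(1,2) that by (rule funpow_poisson_cmult)
    have ad: "(X ^^ n) (\<lambda>p. G p + G' p) = (\<lambda>p. (X ^^ n) G p + (X ^^ n) G' p)"
      if "smooth_on G (B \<times> UNIV)" "smooth_on G' (B \<times> UNIV)" for G G'
      unfolding X_def using assms(1,2) that by (rule funpow_poisson_add)
    have "(X ^^ n) (F (k - n)) p = (-1) ^ (k - n) / fact (k - n) * (X ^^ (n + (k - n))) P p
        + c (k - n) * (X ^^ (n + (k - n - 1))) Q p"
      unfolding F X_def[symmetric] c_def[symmetric]
        ad[OF smooth_on_cmult[OF op sP] smooth_on_cmult[OF op sQ]] cm[OF sP] cm[OF sQ] comp ..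
    \<comment> \<open>At \<open>n = k\<close> truncated subtraction would give the exponent
      \<open>k\<close> in place of \<open>k - 1\<close>, but there \<open>c 0 = 0\<close>.\<close>
    moreover have "c (k - n) * (X ^^ (n + (k - n - 1))) Q p = c (k - n) * (X ^^ (k - 1)) Q p"
    proof (cases "k - n")
      case (Suc m)
      then have "n + (k - n - 1) = k - 1" by simp
      then show ?thesis by (rule arg_cong)
    qed (simp add: c_def)
    ultimately show ?thesis using that by simp
  qed
  \<comment> \<open>The summand \<open>n = k\<close> vanishes because \<open>c 0 = 0\<close>; what
    remains is the alternating sum of order \<open>k - 1\<close>.\<close>
  have csum: "(\<Sum>n\<le>k. 1 / fact n * c (k - n)) = (if k = 1 then 1 else 0)"
  proof (cases k)
    case (Suc j)
    have "c (Suc j - n) = (-1) ^ (j - n) / fact (j - n)" if "n \<le> j" for n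
      using that by (simp add: c_def Suc_diff_le)
    moreover have "c 0 = 0" by (simp add: c_def)
    ultimately have "(\<Sum>n\<le>k. 1 / fact n * c (k - n))
        = (\<Sum>n\<le>j. 1 / fact n * ((-1) ^ (j - n) / fact (j - n)))"
      unfolding Suc sum.atMost_Suc by simp
    then show ?thesis by (simp only: sum_inverse_fact_alternating Suc) simp
  qed (simp add: c_def)
  have "formal_op_series (exp_coeff 1) X F k p
      = (\<Sum>n\<le>k. 1 / fact n * ((-1) ^ (k - n) / fact (k - n) * (X ^^ k) P p + c (k - n) * (X ^^ (k - 1)) Q p))"
    unfolding formal_op_series_def by (intro sum.cong) (simp_all add: XF exp_coeff_def)
  also have "\<dots> = (\<Sum>n\<le>k. 1 / fact n * ((-1) ^ (k - n) / fact (k - n))) * (X ^^ k) P p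
      + (\<Sum>n\<le>k. 1 / fact n * c (k - n)) * (X ^^ (k - 1)) Q p"
    by (simp add: sum_distrib_right sum.distrib distrib_left mult.assoc)
  also have "\<dots> = (order0 P + order1 Q) k p"
    unfolding sum_inverse_fact_alternating csum by (auto simp: order0_def order1_def)
  finally show "formal_op_series (exp_coeff 1) (poisson B H) F k p = (order0 P + order1 Q) k p"
    unfolding X_def .
qed

lemma op_series_exp_poisson_inverse:
  assumes "open B" "smooth_on H (B \<times> UNIV)" "smooth_on K (B \<times> UNIV)" "smooth_on G (B \<times> UNIV)"
    and "\<And>p. p \<in> B \<times> UNIV \<Longrightarrow> (\<lambda>n. (-1) ^ n / fact n * (poisson B H ^^ n) K p) sums G p"
    and "op_series_converges B (exp_coeff 1) (poisson B H) G"
    and out: "\<And>p. fst p \<notin> B \<Longrightarrow> G p = 0" "\<And>p. fst p \<notin> B \<Longrightarrow> K p = 0"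
  shows "op_series (exp_coeff 1) (poisson B H) G = K"
proof
  fix p :: "(real ^ 'a) \<times> (real ^ 'a)"
  show "op_series (exp_coeff 1) (poisson B H) G p = K p"
  proof (cases "fst p \<in> B")
    case True
    have "(\<Sum>n. 1 / fact n * (poisson B H ^^ n) G p) = K p"
    proof (rule exp_poisson_inverse[OF assms(1-5)])
      show "summable (\<lambda>n. 1 / fact n * (poisson B H ^^ n) G q)" if "q \<in> B \<times> UNIV" for q
        using assms(6) that by (auto simp: op_series_converges_def exp_coeff_def)
      show "p \<in> B \<times> UNIV" using True by (simp add: mem_Times_iff)
    qed
    then show ?thesis by (simp add: op_series_def exp_coeff_def)
  next
    case False
    \<comment> \<open>Outside the phase space the bracket takes its default value 0, and the zeroth
      iterate vanishes by the assumption on \<open>G\<close>.\<close>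
    have "(poisson B H ^^ n) G p = 0" for n
      using False out by (cases n) (simp_all add: poisson_def)
    then show ?thesis using out(2)[OF False] by (simp add: op_series_def)
  qed
qed

text \<open>The exponential of a bracket need not converge on smooth functions, so the identity has
  two readings: between functions when the series converge and the control term is an observable,
  and order by order for formal series without any convergence.\<close>

theorem proposition1:
  fixes B :: "(real ^ 'l::finite) set"
    and H\<^sub>0 V :: "'l phase_fun"
    and \<Gamma> :: "'l phase_fun \<Rightarrow> 'l phase_fun"
  assumes "open B"
    and "H\<^sub>0 \<in> observables B"
    and "depends_only_on_actions H\<^sub>0"
    and "linear_operator_on_observables B \<Gamma>"
    and "\<forall>W\<in>observables B. poisson B H\<^sub>0 (poisson B H\<^sub>0 (\<Gamma> W)) = poisson B H\<^sub>0 W"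
    and "V \<in> observables B"
  shows "(op_series_converges B (exp_coeff (-1)) (poisson B (\<Gamma> V)) (op_R B H\<^sub>0 \<Gamma> V)
          \<and> op_series_converges B phi_coeff (poisson B (\<Gamma> V)) (op_N B H\<^sub>0 \<Gamma> V)
          \<and> control_term B H\<^sub>0 \<Gamma> V \<in> observables B
          \<and> op_series_converges B (exp_coeff 1) (poisson B (\<Gamma> V)) (H\<^sub>0 + V + control_term B H\<^sub>0 \<Gamma> V)
          \<longrightarrow> op_series (exp_coeff 1) (poisson B (\<Gamma> V)) (H\<^sub>0 + V + control_term B H\<^sub>0 \<Gamma> V)
              = H\<^sub>0 + op_R B H\<^sub>0 \<Gamma> V)
       \<and> formal_op_series (exp_coeff 1) (poisson B (\<Gamma> V))
            (order0 H\<^sub>0 + order1 V + formal_control_term B H\<^sub>0 \<Gamma> V)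
          = order0 H\<^sub>0 + order1 (op_R B H\<^sub>0 \<Gamma> V)"
proof (intro conjI impI)
  have "\<Gamma> V \<in> observables B" using assms(4,6) by (simp add: linear_operator_on_observables_def)
  then have sH: "smooth_on H\<^sub>0 (B \<times> UNIV)" and sV: "smooth_on V (B \<times> UNIV)"
    and sG: "smooth_on (\<Gamma> V) (B \<times> UNIV)"
    using assms(2,6) by (simp_all add: observables_def)
  have op: "open (B \<times> (UNIV :: (real ^ 'l) set))" using assms(1) by (simp add: open_Times)
  have R: "op_R B H\<^sub>0 \<Gamma> V = (\<lambda>p. V p - poisson B H\<^sub>0 (\<Gamma> V) p)"
    by (simp add: op_R_def op_N_def fun_eq_iff)
  have sR: "smooth_on (op_R B H\<^sub>0 \<Gamma> V) (B \<times> UNIV)"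
    unfolding R by (intro smooth_on_diff smooth_on_poisson assms op sV sH sG)
  show "formal_op_series (exp_coeff 1) (poisson B (\<Gamma> V))
      (order0 H\<^sub>0 + order1 V + formal_control_term B H\<^sub>0 \<Gamma> V) = order0 H\<^sub>0 + order1 (op_R B H\<^sub>0 \<Gamma> V)"
    by (rule formal_exp_inverse[OF assms(1) sG sH sR formal_control_term_eq[where \<Gamma> = \<Gamma> and V = V, OF assms(1) sG sH]])
  have out: "F p = 0" if "F \<in> observables B" "fst p \<notin> B" for F p
    using that by (cases p) (simp add: observables_def)
  assume conv: "op_series_converges B (exp_coeff (-1)) (poisson B (\<Gamma> V)) (op_R B H\<^sub>0 \<Gamma> V)
    \<and> op_series_converges B phi_coeff (poisson B (\<Gamma> V)) (op_N B H\<^sub>0 \<Gamma> V)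
    \<and> control_term B H\<^sub>0 \<Gamma> V \<in> observables B
    \<and> op_series_converges B (exp_coeff 1) (poisson B (\<Gamma> V)) (H\<^sub>0 + V + control_term B H\<^sub>0 \<Gamma> V)"
  then have obs: "control_term B H\<^sub>0 \<Gamma> V \<in> observables B" by blast
  have "op_series (exp_coeff 1) (poisson B (\<Gamma> V)) (H\<^sub>0 + V + control_term B H\<^sub>0 \<Gamma> V)
      = (\<lambda>p. H\<^sub>0 p + op_R B H\<^sub>0 \<Gamma> V p)"
  proof (rule op_series_exp_poisson_inverse[OF assms(1) sG])
    show "smooth_on (\<lambda>p. H\<^sub>0 p + op_R B H\<^sub>0 \<Gamma> V p) (B \<times> UNIV)"
      by (intro smooth_on_add op sH sR)
    \<comment> \<open>Smoothness comes from membership in the observables; a pointwise limit of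
      smooth functions need not be smooth.\<close>
    have "smooth_on (control_term B H\<^sub>0 \<Gamma> V) (B \<times> UNIV)" using obs by (simp add: observables_def)
    then show "smooth_on (H\<^sub>0 + V + control_term B H\<^sub>0 \<Gamma> V) (B \<times> UNIV)"
      unfolding plus_fun_def by (intro smooth_on_add op sH sV)
    show "(\<lambda>n. (-1) ^ n / fact n * (poisson B (\<Gamma> V) ^^ n) (\<lambda>p. H\<^sub>0 p + op_R B H\<^sub>0 \<Gamma> V p) p)
        sums (H\<^sub>0 + V + control_term B H\<^sub>0 \<Gamma> V) p" if "p \<in> B \<times> UNIV" for p
      using conv that by (intro exp_minus_eq_control_term[where \<Gamma> = \<Gamma> and V = V, OF assms(1) sG sH sR]) blast+
    show "op_series_converges B (exp_coeff 1) (poisson B (\<Gamma> V)) (H\<^sub>0 + V + control_term B H\<^sub>0 \<Gamma> V)"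
      using conv by blast
    fix p :: "(real ^ 'l) \<times> (real ^ 'l)"
    assume p: "fst p \<notin> B"
    show "(H\<^sub>0 + V + control_term B H\<^sub>0 \<Gamma> V) p = 0"
      using out[OF assms(2) p] out[OF assms(6) p] out[OF obs p] by simp
    show "H\<^sub>0 p + op_R B H\<^sub>0 \<Gamma> V p = 0"
      using out[OF assms(2) p] out[OF assms(6) p] p by (simp add: R poisson_def)
  qed
  then show "op_series (exp_coeff 1) (poisson B (\<Gamma> V)) (H\<^sub>0 + V + control_term B H\<^sub>0 \<Gamma> V)
      = H\<^sub>0 + op_R B H\<^sub>0 \<Gamma> V"
    unfolding plus_fun_def .
qed

end
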